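(* Let $k\in\mathbb{R}\setminus\{0\}$, $\varrho_k(x)=\exp(-2\pi i k x)$ for $x\in[0,1]$, and $n\ge1$. Consider the space $H^1_0([0,1])$. For nodes $0=x_0<x_1<x_2<\dots<x_n<x_{n+1}=1$ put $L_j=x_{j+1}-x_j$, $j=0,1,\dots,n$, and $N(f)=(f(x_1),\dots,f(x_n))$. Then the radius of information is $$r(N)=\frac{1}{2\pi|k|}\left(1-\frac{1}{k^2\pi^2}\sum_{j=0}^n\frac{\sin^2(\pi k L_j)}{L_j}\right)^{1/2}.$$ Moreover, if $n\ge 2.7|k|-1$, then equidistant nodes (that is, $L_j=\frac{1}{n+1}$ for $j=0,1,\dots,n$) are optimal (they minimize $r(N)$ over all choices of $n$ nodes), and the $n$th minimal worst case error is $$e(n,I_{\varrho_k},H^1_0)=\frac{1}{2\pi|k|}\left(1-\frac{(n+1)^2}{k^2\pi^2}\sin^2\left(\frac{k\pi}{n+1}\right)\right)^{1/2}.$$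
   Context: $H^1_0([0,1])$ is the space of all absolutely continuous $f:[0,1]\to\mathbb{C}$ with $f'\in L_2([0,1])$ and $f(0)=f(1)=0$, with norm $\|f\|:=\|f'\|_{L_2}$. Set $I_{\varrho_k}(f)=\int_0^1 f(x)\varrho_k(x)\,dx$. The radius of the information $N$ is $r(N)=\sup\{|I_{\varrho_k}(f)|: f\in H^1_0([0,1]),\ \|f\|\le1,\ N(f)=0\}$; it equals the worst case error over the unit ball of an optimal algorithm using the information $N$. The $n$th minimal worst case error is $e(n,I_{\varrho_k},H^1_0)=\inf_{A_n}\sup_{f\in H^1_0([0,1]),\,\|f\|\le 1}|I_{\varrho_k}(f)-A_n(f)|$, where the infimum is over all algorithms $A_n(f)=\phi(f(x_1),\dots,f(x_n))$ using at most $n$ function values (arbitrary nodes in $[0,1]$ and arbitrary $\phi:\mathbb{C}^n\to\mathbb{C}$). *)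

theory Defs
  imports "HOL-Analysis.Analysis"
begin

(* The members K of a division d are compact intervals [Inf K, Sup K] with pairwise disjoint
   interiors. *)
definition absolutely_continuous_on :: "real set \<Rightarrow> (real \<Rightarrow> 'a::real_normed_vector) \<Rightarrow> bool" where
  "absolutely_continuous_on S f \<longleftrightarrow>
     (\<forall>\<epsilon>>0. \<exists>\<delta>>0. \<forall>d T. d division_of T \<and> T \<subseteq> S \<and> (\<Sum>K\<in>d. Sup K - Inf K) < \<delta> \<longrightarrow>
        (\<Sum>K\<in>d. norm (f (Sup K) - f (Inf K))) < \<epsilon>)"

definition square_integrable_on :: "real set \<Rightarrow> (real \<Rightarrow> complex) \<Rightarrow> bool" where
  "square_integrable_on S g \<longleftrightarrow>
     set_borel_measurable lebesgue S g \<and> set_integrable lebesgue S (\<lambda>x. (cmod (g x))\<^sup>2)"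

(* One-sided derivative at the endpoints; an unspecified constant wherever f is not
   differentiable. *)
definition deriv01 :: "(real \<Rightarrow> complex) \<Rightarrow> real \<Rightarrow> complex" where
  "deriv01 f x = vector_derivative f (at x within {0..1})"

(* Only the values of f on [0,1] matter. Almost everywhere differentiability follows from
   absolute continuity; it is listed because the derivative is a total function here, so that
   its square integrability alone does not express that the derivative exists. *)
definition H10 :: "(real \<Rightarrow> complex) set" where
  "H10 = {f. absolutely_continuous_on {0..1} f \<and>
             (AE x\<in>{0..1} in lebesgue. f differentiable (at x within {0..1})) \<and>
             square_integrable_on {0..1} (deriv01 f) \<and>
             f 0 = 0 \<and> f 1 = 0}"

definition H10_norm :: "(real \<Rightarrow> complex) \<Rightarrow> real" where
  "H10_norm f = sqrt (LINT x:{0..1}|lebesgue. (cmod (deriv01 f x))\<^sup>2)"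

definition H10_ball :: "(real \<Rightarrow> complex) set" where
  "H10_ball = {f \<in> H10. H10_norm f \<le> 1}"

definition osc_weight :: "real \<Rightarrow> real \<Rightarrow> complex" where
  "osc_weight k x = exp (- 2 * of_real pi * \<i> * of_real k * of_real x)"

definition weighted_integral :: "(real \<Rightarrow> complex) \<Rightarrow> (real \<Rightarrow> complex) \<Rightarrow> complex" where
  "weighted_integral \<rho> f = (LINT x:{0..1}|lebesgue. f x * \<rho> x)"

(* Suprema and infima are taken in ereal: the error of an algorithm with arbitrary \<phi> can be
   infinite. *)
definition radius_of_information ::
    "((real \<Rightarrow> complex) \<Rightarrow> complex) \<Rightarrow> ((real \<Rightarrow> complex) \<Rightarrow> complex list) \<Rightarrow> ereal" where
  "radius_of_information S N =
     (SUP f\<in>{f \<in> H10_ball. \<forall>y\<in>set (N f). y = 0}. ereal (cmod (S f)))"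

definition worst_case_error ::
    "((real \<Rightarrow> complex) \<Rightarrow> complex) \<Rightarrow> ((real \<Rightarrow> complex) \<Rightarrow> complex) \<Rightarrow> ereal" where
  "worst_case_error S A = (SUP f\<in>H10_ball. ereal (cmod (S f - A f)))"

definition sampling_algorithms :: "nat \<Rightarrow> ((real \<Rightarrow> complex) \<Rightarrow> complex) set" where
  "sampling_algorithms n =
     {A. \<exists>xs \<phi>. length xs \<le> n \<and> set xs \<subseteq> {0..1} \<and> A = (\<lambda>f. \<phi> (map f xs))}"

definition minimal_worst_case_error :: "nat \<Rightarrow> ((real \<Rightarrow> complex) \<Rightarrow> complex) \<Rightarrow> ereal" where
  "minimal_worst_case_error n S = (INF A\<in>sampling_algorithms n. worst_case_error S A)"

definition node_sequence :: "nat \<Rightarrow> (nat \<Rightarrow> real) \<Rightarrow> bool" where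
  "node_sequence n x \<longleftrightarrow> x 0 = 0 \<and> x (n + 1) = 1 \<and> (\<forall>j\<le>n. x j < x (j + 1))"

definition node_information :: "nat \<Rightarrow> (nat \<Rightarrow> real) \<Rightarrow> (real \<Rightarrow> complex) \<Rightarrow> complex list" where
  "node_information n x f = map (\<lambda>j. f (x j)) [1..<n + 1]"

definition equidistant_nodes :: "nat \<Rightarrow> nat \<Rightarrow> real" where
  "equidistant_nodes n j = real j / real (n + 1)"

end

theory Submission
  imports Defs
begin

text \<open>
  Let \<open>G\<close> be an antiderivative of the weight \<open>\<rho>\<close> and \<open>c\<^sub>j\<close> its mean over the \<open>j\<close>-th subinterval.
  Integration by parts on each subinterval expresses the integral of \<open>f \<rho>\<close> by boundary values at the
  nodes minus the integral of \<open>f' (G - c\<^sub>j)\<close>. The boundary values are an algorithm whose error is at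
  most the \<open>L\<^sub>2\<close> norm of \<open>G - c\<^sub>j\<close>, and equality holds for \<open>f'\<close> proportional to the conjugate of
  \<open>G - c\<^sub>j\<close>, that is, for the conjugate of the error of piecewise linear interpolation of an
  antiderivative of \<open>G\<close>; this \<open>f\<close> vanishes at the nodes precisely because \<open>c\<^sub>j\<close> is the mean.

  Minimising over the nodes amounts to maximising the sum of \<open>g(2\<pi>|k|L\<^sub>j)\<close> with
  \<open>g(u) = (1 - cos u) / u\<close>. As long as the equidistant argument \<open>2\<pi>|k| / (n + 1)\<close> does not exceed the
  maximiser of \<open>g\<close>, the tangent line at this argument lies above \<open>g\<close> on the whole positive axis.
\<close>

section \<open>Absolutely continuous functions\<close>

text \<open>Two members of a division meet in a convex set with empty interior, which is negligible,
  so their lengths add up to the measure of the union. This turns a set of small measure into the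
  smallness condition of absolute continuity.\<close>

lemma division_lengths_le_measure:
  fixes d :: "real set set"
  assumes d: "d division_of T" and "T \<subseteq> U" and U: "U \<in> lmeasurable"
  shows "(\<Sum>K\<in>d. Sup K - Inf K) \<le> measure lebesgue U"
proof -
  note D = division_ofD[OF d]
  have cb: "\<exists>u v. K = {u..v} \<and> u \<le> v" if "K \<in> d" for K
    using D(3)[OF that] D(4)[OF that] by (metis atLeastatMost_empty_iff2 box_real(2))
  have len: "Sup K - Inf K = measure lebesgue K" if "K \<in> d" for K
    using cb[OF that] by auto
  have "pairwise (\<lambda>K K'. negligible (K \<inter> K')) d"
    unfolding pairwise_def
  proof (intro ballI impI)
    fix K K' assume K: "K \<in> d" "K' \<in> d" "K \<noteq> K'"
    have "convex (K \<inter> K')"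
      using cb[OF K(1)] cb[OF K(2)] by (auto intro!: convex_Int)
    then show "negligible (K \<inter> K')"
      using D(5)[OF K] by (simp add: negligible_convex_interior)
  qed
  then have "measure lebesgue (\<Union>d) = (\<Sum>K\<in>d. measure lebesgue K)"
    using D(1) cb by (intro measure_negligible_finite_Union) auto
  moreover have "measure lebesgue (\<Union>d) \<le> measure lebesgue U"
    using assms D(6) lmeasurable_division[OF d] by (intro measure_mono_fmeasurable) auto
  ultimately show ?thesis
    using len by simp
qed

lemma absolutely_continuous_onE:
  assumes "absolutely_continuous_on S f" "\<epsilon> > 0"
  obtains \<delta> where "\<delta> > 0"
    "\<And>d T. \<lbrakk>d division_of T; T \<subseteq> S; (\<Sum>K\<in>d. Sup K - Inf K) < \<delta>\<rbrakk>
        \<Longrightarrow> (\<Sum>K\<in>d. norm (f (Sup K) - f (Inf K))) < \<epsilon>"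
proof -
  from assms have "\<exists>\<delta>>0. \<forall>d T. d division_of T \<and> T \<subseteq> S \<and> (\<Sum>K\<in>d. Sup K - Inf K) < \<delta> \<longrightarrow>
        (\<Sum>K\<in>d. norm (f (Sup K) - f (Inf K))) < \<epsilon>"
    unfolding absolutely_continuous_on_def by simp
  then show thesis
    by (elim exE conjE) (rule that, auto)
qed

lemma absolutely_continuous_on_subset:
  "absolutely_continuous_on S f \<Longrightarrow> T \<subseteq> S \<Longrightarrow> absolutely_continuous_on T f"
  unfolding absolutely_continuous_on_def by (meson subset_trans)

text \<open>The domination passes to sums over a division. It serves two purposes: with
  \<open>A = 0\<close> it covers Lipschitz functions, and in general products of \<open>f\<close>
  with a Lipschitz function.\<close>

lemma absolutely_continuous_on_lipschitz_sum:
  assumes f: "absolutely_continuous_on S f"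
    and le: "\<And>u v. \<lbrakk>u \<in> S; v \<in> S; u \<le> v\<rbrakk> \<Longrightarrow> norm (g v - g u) \<le> A * norm (f v - f u) + B * (v - u)"
    and AB: "A \<ge> 0" "B \<ge> 0"
  shows "absolutely_continuous_on S g"
  unfolding absolutely_continuous_on_def
proof (intro allI impI)
  fix e :: real assume "e > 0"
  \<comment> \<open>The \<open>+ 1\<close> here and in \<open>\<delta>'\<close> keeps the
    denominators positive and makes each of the two contributions strictly less than
    \<open>e / 2\<close>, even for \<open>A = 0\<close> or \<open>B = 0\<close>.\<close>
  define e' where "e' = e / (2 * (A + 1))"
  have e': "e' > 0" using \<open>e > 0\<close> AB by (auto simp: e'_def)
  obtain \<delta> where \<delta>: "\<delta> > 0" and del: "\<And>d T. \<lbrakk>d division_of T; T \<subseteq> S; (\<Sum>K\<in>d. Sup K - Inf K) < \<delta>\<rbrakk>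
      \<Longrightarrow> (\<Sum>K\<in>d. norm (f (Sup K) - f (Inf K))) < e'"
    by (rule absolutely_continuous_onE[OF f e']) (rule that)
  define \<delta>' where "\<delta>' = min \<delta> (e / (2 * (B + 1)))"
  show "\<exists>\<delta>>0. \<forall>d T. d division_of T \<and> T \<subseteq> S \<and> (\<Sum>K\<in>d. Sup K - Inf K) < \<delta> \<longrightarrow>
        (\<Sum>K\<in>d. norm (g (Sup K) - g (Inf K))) < e"
  proof (intro exI[of _ \<delta>'] conjI allI impI)
    show "\<delta>' > 0" using \<delta> \<open>e > 0\<close> AB by (auto simp: \<delta>'_def)
  next
    fix d T assume H: "d division_of T \<and> T \<subseteq> S \<and> (\<Sum>K\<in>d. Sup K - Inf K) < \<delta>'"
    note D = division_ofD[OF H[THEN conjunct1]]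
    have mem: "Inf K \<in> S \<and> Sup K \<in> S \<and> Inf K \<le> Sup K" if K: "K \<in> d" for K
    proof -
      obtain u v where "K = cbox u v" using D(4)[OF K] by blast
      with D(3)[OF K] have "u \<le> v" "K = {u..v}" by auto
      then show ?thesis using D(2)[OF K] H by auto
    qed
    have "(\<Sum>K\<in>d. norm (g (Sup K) - g (Inf K)))
        \<le> (\<Sum>K\<in>d. A * norm (f (Sup K) - f (Inf K)) + B * (Sup K - Inf K))"
      using mem by (intro sum_mono le) auto
    also have "\<dots> = A * (\<Sum>K\<in>d. norm (f (Sup K) - f (Inf K))) + B * (\<Sum>K\<in>d. Sup K - Inf K)"
      by (simp add: sum.distrib sum_distrib_left)
    also have "\<dots> \<le> A * e' + B * (e / (2 * (B + 1)))"
      using H del[of d T] AB by (intro add_mono mult_left_mono) (auto simp: \<delta>'_def)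
    also have "\<dots> < e / 2 + e / 2"
      using AB \<open>e > 0\<close> by (intro add_strict_mono) (auto simp: e'_def field_simps)
    finally show "(\<Sum>K\<in>d. norm (g (Sup K) - g (Inf K))) < e" by simp
  qed
qed

lemma absolutely_continuous_on_lipschitz:
  fixes g :: "real \<Rightarrow> 'a::real_normed_vector"
  assumes "\<And>u v. \<lbrakk>u \<in> S; v \<in> S; u \<le> v\<rbrakk> \<Longrightarrow> norm (g v - g u) \<le> B * (v - u)" "B \<ge> 0"
  shows "absolutely_continuous_on S g"
  by (rule absolutely_continuous_on_lipschitz_sum[where A = 0 and B = B and f = "\<lambda>_. 0::'a"])
     (use assms in \<open>auto simp: absolutely_continuous_on_def intro!: exI[of _ 1]\<close>)

lemma absolutely_continuous_on_imp_continuous_on: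
  assumes f: "absolutely_continuous_on {a..b} f"
  shows "continuous_on {a..b} f"
  unfolding continuous_on_iff
proof (intro ballI allI impI)
  fix x e :: real assume x: "x \<in> {a..b}" and e: "e > 0"
  obtain \<delta> where \<delta>: "\<delta> > 0" and del: "\<And>d T. \<lbrakk>d division_of T; T \<subseteq> {a..b}; (\<Sum>K\<in>d. Sup K - Inf K) < \<delta>\<rbrakk>
      \<Longrightarrow> (\<Sum>K\<in>d. norm (f (Sup K) - f (Inf K))) < e"
    by (rule absolutely_continuous_onE[OF f e]) (rule that)
  have "norm (f v - f u) < e" if "u \<in> {a..b}" "v \<in> {a..b}" "u \<le> v" "v - u < \<delta>" for u v
    using del[OF division_of_self[of u v]] that by auto
  note less = this
  have "dist (f y) (f x) < e" if "y \<in> {a..b}" "dist y x < \<delta>" for y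
    using less[of x y] less[of y x] that x
    by (cases "x \<le> y") (simp_all add: dist_norm norm_minus_commute)
  then show "\<exists>\<delta>>0. \<forall>y\<in>{a..b}. dist y x < \<delta> \<longrightarrow> dist (f y) (f x) < e"
    using \<delta> by blast
qed

text \<open>The gauge is the one of the usual proof at points where \<open>F\<close> is differentiable; tags in
  the exceptional null set are confined to an open set of small measure, where absolute continuity
  bounds the increments of \<open>F\<close>.\<close>

theorem fundamental_theorem_of_calculus_absolutely_continuous:
  fixes F :: "real \<Rightarrow> 'a::banach"
  assumes "a \<le> b" and ac: "absolutely_continuous_on {a..b} F" and N: "negligible N"
    and vec: "\<And>x. x \<in> {a..b} - N \<Longrightarrow> (F has_vector_derivative F' x) (at x within {a..b})"
  shows "(F' has_integral (F b - F a)) {a..b}"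
proof -
  \<comment> \<open>With value 0 on \<open>N\<close>, a tag in \<open>N\<close> contributes only an
    increment of \<open>F\<close> to the Riemann sum. The value of \<open>F'\<close> there, possibly
    huge, never enters.\<close>
  define g where "g x = (if x \<in> N then 0 else F' x)" for x
  have "(g has_integral (F b - F a)) {a..b}"
    unfolding has_integral_real
  proof (intro allI impI)
    fix e :: real assume "e > 0"
    define e1 where "e1 = e / (2 * (b - a + 1))"
    have e1: "e1 > 0" "e1 * (b - a) < e / 2"
      using \<open>e > 0\<close> \<open>a \<le> b\<close> by (auto simp: e1_def field_simps)
    obtain \<delta> where \<delta>: "\<delta> > 0" and del: "\<And>d T. \<lbrakk>d division_of T; T \<subseteq> {a..b}; (\<Sum>K\<in>d. Sup K - Inf K) < \<delta>\<rbrakk>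
        \<Longrightarrow> (\<Sum>K\<in>d. norm (F (Sup K) - F (Inf K))) < e / 2"
      by (rule absolutely_continuous_onE[OF ac half_gt_zero[OF \<open>e > 0\<close>]]) (rule that)
    have N0: "N \<in> null_sets lebesgue" using N by (simp add: negligible_iff_null_sets)
    then have "N \<in> sets lebesgue" by auto
    then obtain U where U: "open U" "N \<subseteq> U" "U - N \<in> lmeasurable" "emeasure lebesgue (U - N) < ennreal \<delta>"
      using sets_lebesgue_outer_open \<delta> by metis
    have Ul: "U \<in> lmeasurable"
      using U(2,3) N by (metis Diff_partition fmeasurable.Un negligible_imp_measurable)
    have Um: "measure lebesgue U < \<delta>"
      using U(3,4) N0 \<delta> U(1) by (metis borel_open emeasure_eq_measure2 ennreal_less_iff measure_Diff_null_set measure_nonneg sets_completionI_sets sets_lborel)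
    have "\<forall>x. \<exists>d>0. (x \<in> N \<longrightarrow> ball x d \<subseteq> U) \<and> (x \<in> {a..b} - N \<longrightarrow>
         (\<forall>y\<in>{a..b}. norm (y-x) < d \<longrightarrow> norm (F y - F x - (y-x) *\<^sub>R g x) \<le> e1 * norm (y-x)))"
    proof
      fix x
      consider "x \<in> N" | "x \<in> {a..b} - N" | "x \<notin> N" "x \<notin> {a..b}" by blast
      then show "\<exists>d>0. (x \<in> N \<longrightarrow> ball x d \<subseteq> U) \<and> (x \<in> {a..b} - N \<longrightarrow>
         (\<forall>y\<in>{a..b}. norm (y-x) < d \<longrightarrow> norm (F y - F x - (y-x) *\<^sub>R g x) \<le> e1 * norm (y-x)))"
      proof cases
        case 1
        then show ?thesis using U by (metis DiffD2 openE subsetD)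
      next
        case 2
        then show ?thesis using vec[OF 2] e1(1)
          unfolding has_vector_derivative_def has_derivative_within_alt g_def by auto
      next
        case 3
        then show ?thesis by (auto intro: exI[of _ 1])
      qed
    qed
    then obtain r where r: "\<And>x. 0 < r x" "\<And>x. x \<in> N \<Longrightarrow> ball x (r x) \<subseteq> U"
      "\<And>x y. \<lbrakk>x \<in> {a..b}; x \<notin> N; y \<in> {a..b}; norm (y-x) < r x\<rbrakk>
         \<Longrightarrow> norm (F y - F x - (y-x) *\<^sub>R g x) \<le> e1 * norm (y-x)"
      by (metis DiffI)
    show "\<exists>\<gamma>. gauge \<gamma> \<and> (\<forall>p. p tagged_division_of {a..b} \<and> \<gamma> fine p \<longrightarrow>
        norm ((\<Sum>(x,K)\<in>p. measure lborel K *\<^sub>R g x) - (F b - F a)) < e)"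
    proof (intro exI[of _ "\<lambda>x. ball x (r x)"] conjI allI impI)
      show "gauge (\<lambda>x. ball x (r x))" using r(1) gauge_ball_dependent by blast
      fix p assume p: "p tagged_division_of {a..b} \<and> (\<lambda>x. ball x (r x)) fine p"
      then have ptag: "p tagged_division_of {a..b}" and fine: "(\<lambda>x. ball x (r x)) fine p" by auto
      note P = tagged_division_ofD[OF ptag]
      have iv: "\<exists>u v. K = {u..v} \<and> u \<le> x \<and> x \<le> v \<and> a \<le> u \<and> v \<le> b" if "(x, K) \<in> p" for x K
        using P(2,3,4)[OF that] by fastforce
      define p1 where "p1 = {(x,K) \<in> p. x \<in> N}"
      define p2 where "p2 = {(x,K) \<in> p. x \<notin> N}"
      have p12: "p = p1 \<union> p2" "p1 \<inter> p2 = {}" "finite p1" "finite p2"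
        using P(1) unfolding p1_def p2_def by (auto elim: rev_finite_subset)
      let ?h = "\<lambda>(x,K). measure lborel K *\<^sub>R g x - (F (Sup K) - F (Inf K))"
      have "(\<Sum>(x,K)\<in>p. measure lborel K *\<^sub>R g x) - (F b - F a) = sum ?h p"
        using additive_tagged_division_1[OF \<open>a \<le> b\<close> ptag, of F]
        by (simp add: sum_subtractf case_prod_unfold)
      also have "\<dots> = sum ?h p1 + sum ?h p2"
        unfolding p12(1) by (rule sum.union_disjoint[OF p12(3,4,2)])
      finally have split: "norm ((\<Sum>(x,K)\<in>p. measure lborel K *\<^sub>R g x) - (F b - F a)) \<le> norm (sum ?h p1) + norm (sum ?h p2)"
        by (simp only: norm_triangle_ineq)
      have "norm (sum ?h p2) \<le> (\<Sum>z\<in>p2. e1 * (case z of (x,K) \<Rightarrow> Sup K - Inf K))"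
      proof (rule sum_norm_le, safe)
        fix x K assume "(x,K) \<in> p2"
        then have xK: "(x,K) \<in> p" "x \<notin> N" by (auto simp: p2_def)
        then obtain u v where K: "K = {u..v}" "u \<le> x" "x \<le> v" "a \<le> u" "v \<le> b"
          using iv[OF xK(1)] by (elim exE conjE)
        have "K \<subseteq> ball x (r x)" using fine xK by (auto simp: fine_def)
        moreover have "u \<in> K" "v \<in> K" using K by auto
        ultimately have "u \<in> ball x (r x)" "v \<in> ball x (r x)" by blast+
        then have "norm (F u - F x - (u-x) *\<^sub>R g x) \<le> e1 * norm (u - x)"
          "norm (F v - F x - (v-x) *\<^sub>R g x) \<le> e1 * norm (v - x)"
          using K xK r(3)[of x u] r(3)[of x v] by (simp_all add: dist_real_def)
        \<comment> \<open>The tag lies between the endpoints, so the distances from \<open>x\<close>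
          to \<open>u\<close> and to \<open>v\<close> add up to exactly
          \<open>v - u\<close>.\<close>
        then have "norm ((F u - F x - (u-x) *\<^sub>R g x) - (F v - F x - (v-x) *\<^sub>R g x)) \<le> e1 * (v - u)"
          using norm_triangle_ineq4[of "F u - F x - (u-x) *\<^sub>R g x" "F v - F x - (v-x) *\<^sub>R g x"] K
          by (simp add: algebra_simps)
        then show "norm (measure lborel K *\<^sub>R g x - (F (Sup K) - F (Inf K))) \<le> e1 * (Sup K - Inf K)"
          using K by (simp add: algebra_simps)
      qed
      also have "\<dots> \<le> (\<Sum>z\<in>p. e1 * (case z of (x,K) \<Rightarrow> Sup K - Inf K))"
      proof (rule sum_mono2[OF P(1)])
        show "p2 \<subseteq> p" using p12(1) by blast
        fix z assume "z \<in> p - p2"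
        then obtain x K where z: "z = (x, K)" "(x, K) \<in> p" by (cases z) auto
        show "0 \<le> e1 * (case z of (x, K) \<Rightarrow> Sup K - Inf K)"
          using iv[OF z(2)] e1(1) z(1) by auto
      qed
      also have "\<dots> = e1 * (b - a)"
        using additive_tagged_division_1[OF \<open>a \<le> b\<close> ptag, of "\<lambda>x. x"] by (simp add: sum_distrib_left[symmetric])
      finally have 2: "norm (sum ?h p2) < e / 2" using e1 by linarith
      have p1p: "p1 tagged_partial_division_of {a..b}"
        using ptag unfolding p1_def by (auto simp: tagged_division_of_def elim: tagged_partial_division_subset)
      note p1t = tagged_partial_division_of_Union_self[OF p1p]
      \<comment> \<open>Passing from tagged pairs to intervals requires a function that vanishes on
        every interval without interior. This includes the empty one, where \<open>Sup\<close> and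
        \<open>Inf\<close> are unspecified.\<close>
      define D where "D K = (if K = {} then 0 else norm (F (Sup K) - F (Inf K)))" for K
      have "norm (sum ?h p1) \<le> (\<Sum>(x,K)\<in>p1. D K)"
      proof (rule sum_norm_le, safe)
        fix x K assume "(x,K) \<in> p1"
        then have xK: "(x,K) \<in> p" "x \<in> N" by (auto simp: p1_def)
        then show "norm (measure lborel K *\<^sub>R g x - (F (Sup K) - F (Inf K))) \<le> D K"
          using P(2)[OF xK(1)] by (auto simp: g_def D_def norm_minus_commute)
      qed
      also have "\<dots> = sum D (snd ` p1)"
        by (rule sum.over_tagged_division_lemma[OF p1t]) (auto simp: D_def antisym)
      also have "\<dots> = (\<Sum>K\<in>snd ` p1. norm (F (Sup K) - F (Inf K)))"
        using P(2) by (intro sum.cong refl) (force simp: D_def p1_def)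
      also have "\<dots> < e / 2"
      proof (rule del[OF division_of_tagged_division[OF p1t]])
        show "\<Union> (snd ` p1) \<subseteq> {a..b}" using P(3) by (force simp: p1_def)
        have "\<Union> (snd ` p1) \<subseteq> U" using r(2) fine by (fastforce simp: p1_def fine_def)
        then show "(\<Sum>K\<in>snd ` p1. Sup K - Inf K) < \<delta>"
          using division_lengths_le_measure[OF division_of_tagged_division[OF p1t] _ Ul] Um by linarith
      qed
      finally have 1: "norm (sum ?h p1) < e / 2" .
      show "norm ((\<Sum>(x,K)\<in>p. measure lborel K *\<^sub>R g x) - (F b - F a)) < e"
        using split 1 2 by linarith
    qed
  qed
  then show ?thesis
    by (rule has_integral_spike[OF N, rotated]) (auto simp: g_def)
qed

section \<open>Intervals subdivided by a finite sequence of points\<close>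

text \<open>The ordering conjunct is carried through the induction because attaching the next
  interval on the right requires it.\<close>

lemma has_integral_combine_increasing:
  fixes x :: "nat \<Rightarrow> real" and g :: "real \<Rightarrow> 'a::banach"
  assumes "\<And>j. j \<le> n \<Longrightarrow> x j \<le> x (Suc j)"
    and "\<And>j. j \<le> n \<Longrightarrow> (g has_integral I j) {x j..x (Suc j)}"
  shows "x 0 \<le> x (Suc n) \<and> (g has_integral (\<Sum>j\<le>n. I j)) {x 0..x (Suc n)}"
  using assms
proof (induction n)
  case 0
  then show ?case by simp
next
  case (Suc n)
  then have IH: "x 0 \<le> x (Suc n)" "(g has_integral (\<Sum>j\<le>n. I j)) {x 0..x (Suc n)}" by auto
  from Suc.prems(1)[of "Suc n"] Suc.prems(2)[of "Suc n"]
  show ?case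
    using has_integral_combine[OF IH(1) _ IH(2), of "x (Suc (Suc n))" "I (Suc n)"] IH(1) by auto
qed

lemma interval_of_increasing:
  fixes x :: "nat \<Rightarrow> real"
  assumes "x 0 \<le> t" "t \<le> x (Suc n)"
  shows "\<exists>j\<le>n. x j \<le> t \<and> t \<le> x (Suc j)"
  using assms
proof (induction n)
  case 0
  then show ?case by auto
next
  case (Suc n)
  then show ?case by (cases "t \<le> x (Suc n)") (auto simp: le_Suc_eq)
qed

section \<open>Radius of information for a general weight\<close>

lemma H10_continuous_on:
  assumes "f \<in> H10"
  shows "continuous_on {0..1} f"
  using assms by (auto simp: H10_def intro: absolutely_continuous_on_imp_continuous_on)

text \<open>Mean value inequality with the derivative bounded by compactness. It is applied to
  \<open>G\<close> with derivative \<rho> and to \<open>F\<close> with derivative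
  \<open>G\<close>.\<close>

lemma lipschitz_of_continuous_derivative:
  fixes G :: "real \<Rightarrow> 'a::real_normed_vector"
  assumes "\<And>t. (G has_vector_derivative \<rho> t) (at t)" "continuous_on UNIV \<rho>"
  obtains B where "B \<ge> 0" "\<And>u v. \<lbrakk>u \<in> {a..b}; v \<in> {a..b}; u \<le> v\<rbrakk> \<Longrightarrow> norm (G v - G u) \<le> B * (v - u)"
proof -
  have "bounded (\<rho> ` {a..b})"
    using assms(2) by (intro compact_imp_bounded compact_continuous_image continuous_on_subset[OF assms(2)]) auto
  then obtain B where B: "B > 0" "\<And>t. t \<in> {a..b} \<Longrightarrow> norm (\<rho> t) \<le> B"
    unfolding bounded_pos by (elim exE conjE) (rule that, auto)
  have "norm (G v - G u) \<le> B * norm (v - u)" if "u \<in> {a..b}" "v \<in> {a..b}" for u v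
  proof (rule differentiable_bound[where S = "{a..b}" and f' = "\<lambda>t h. h *\<^sub>R \<rho> t"])
    fix t assume t: "t \<in> {a..b}"
    show "(G has_derivative (\<lambda>h. h *\<^sub>R \<rho> t)) (at t within {a..b})"
      using has_vector_derivative_at_within[OF assms(1)] by (simp add: has_vector_derivative_def)
    show "onorm (\<lambda>h. h *\<^sub>R \<rho> t) \<le> B"
      using B(2)[OF t] by (intro onorm_le) (simp add: mult.commute[of B] mult_left_mono)
  qed (use that in auto)
  with B(1) show thesis by (intro that[of B]) fastforce+
qed

text \<open>The product of the absolutely continuous \<open>f\<close> with the Lipschitz function
  \<open>G - c\<close> is absolutely continuous, and the product rule holds off a null set, so the
  fundamental theorem applies. The constant \<open>c\<close> stays free; it is later the mean of
  \<open>G\<close> on the subinterval.\<close>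

lemma H10_integration_by_parts:
  assumes f: "f \<in> H10" and ab: "0 \<le> a" "a < b" "b \<le> 1"
    and G: "\<And>t. (G has_vector_derivative \<rho> t) (at t)" and \<rho>: "continuous_on UNIV \<rho>"
  shows "((\<lambda>t. f t * \<rho> t + deriv01 f t * (G t - c)) has_integral
            f b * (G b - c) - f a * (G a - c)) {a..b}"
proof -
  let ?H = "\<lambda>t. f t * (G t - c)"
  have sub: "{a..b} \<subseteq> {0..1}" using ab by auto
  have ac: "absolutely_continuous_on {a..b} f"
    using f sub by (auto simp: H10_def intro: absolutely_continuous_on_subset)
  obtain B where B: "B \<ge> 0" "\<And>u v. \<lbrakk>u \<in> {a..b}; v \<in> {a..b}; u \<le> v\<rbrakk> \<Longrightarrow> cmod (G v - G u) \<le> B * (v - u)"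
    using lipschitz_of_continuous_derivative[OF G \<rho>] by metis
  have cG: "continuous_on {a..b} (\<lambda>t. G t - c)"
    using G has_vector_derivative_continuous
    by (intro continuous_intros continuous_at_imp_continuous_on) blast
  obtain M where M: "M > 0" "\<And>t. t \<in> {a..b} \<Longrightarrow> cmod (G t - c) \<le> M"
    using compact_imp_bounded[OF compact_continuous_image[OF cG compact_Icc]]
    unfolding bounded_pos by (elim exE conjE) (rule that, auto)
  obtain M' where M': "M' > 0" "\<And>t. t \<in> {a..b} \<Longrightarrow> cmod (f t) \<le> M'"
    using compact_imp_bounded[OF compact_continuous_image[OF absolutely_continuous_on_imp_continuous_on[OF ac] compact_Icc]]
    unfolding bounded_pos by (elim exE conjE) (rule that, auto)
  have acH: "absolutely_continuous_on {a..b} ?H"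
  proof (rule absolutely_continuous_on_lipschitz_sum[OF ac, where A = M and B = "M' * B"])
    fix u v assume uv: "u \<in> {a..b}" "v \<in> {a..b}" "u \<le> v"
    \<comment> \<open>Discrete product rule: the first term is controlled by the increment of
      \<open>f\<close>, the second by the Lipschitz bound for \<open>G\<close>.\<close>
    have "?H v - ?H u = (f v - f u) * (G v - c) + f u * (G v - G u)"
      by (simp add: algebra_simps)
    also have "cmod \<dots> \<le> cmod (f v - f u) * cmod (G v - c) + cmod (f u) * cmod (G v - G u)"
      by (metis norm_mult norm_triangle_ineq)
    also have "\<dots> \<le> cmod (f v - f u) * M + M' * (B * (v - u))"
      using M M' B uv by (intro add_mono mult_mono) auto
    finally show "cmod (?H v - ?H u) \<le> M * cmod (f v - f u) + M' * B * (v - u)"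
      by (simp add: algebra_simps)
  qed (use M M' B in auto)
  have "AE t in lebesgue. t \<in> {0..1} \<longrightarrow> f differentiable (at t within {0..1})"
    using f by (simp add: H10_def)
  then obtain N where N: "{t \<in> space lebesgue. \<not> (t \<in> {0..1} \<longrightarrow> f differentiable (at t within {0..1}))} \<subseteq> N"
      "emeasure lebesgue N = 0" "N \<in> sets lebesgue"
    by (rule AE_E)
  show ?thesis
  proof (rule fundamental_theorem_of_calculus_absolutely_continuous[OF _ acH, where N = N])
    show "negligible N" using N by (simp add: negligible_iff_null_sets null_sets_def)
    fix t assume t: "t \<in> {a..b} - N"
    then have "f differentiable (at t within {0..1})" using N(1) subsetD[OF sub, of t] by auto
    then have "(f has_vector_derivative deriv01 f t) (at t within {0..1})"
      by (simp add: deriv01_def vector_derivative_works)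
    then have "(f has_vector_derivative deriv01 f t) (at t within {a..b})"
      using sub by (rule has_vector_derivative_within_subset)
    then have "(?H has_vector_derivative f t * (\<rho> t - 0) + deriv01 f t * (G t - c)) (at t within {a..b})"
      by (intro has_vector_derivative_mult has_vector_derivative_diff has_vector_derivative_const
            has_vector_derivative_at_within[OF G])
    then show "(?H has_vector_derivative f t * \<rho> t + deriv01 f t * (G t - c)) (at t within {a..b})"
      by simp
  qed (use ab in auto)
qed

text \<open>Gives the Lipschitz bound for the ramps out of which the piecewise linear interpolant is
  built.\<close>

lemma clamp_nonexpansive:
  fixes a b u v :: real
  assumes "u \<le> v"
  shows "\<bar>min (max v a) b - min (max u a) b\<bar> \<le> v - u"
  using assms unfolding min_def max_def by (simp split: if_split)

section \<open>Integration by parts over the subintervals between nodes\<close>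

text \<open>Two successive antiderivatives are fixed: \<open>G\<close> appears in the integration by
  parts, while \<open>F\<close> supplies the means of \<open>G\<close> and, through its
  interpolation error, the extremal function.\<close>

locale information_nodes =
  fixes \<rho> G F :: "real \<Rightarrow> complex" and n :: nat and x :: "nat \<Rightarrow> real"
  assumes F_deriv: "\<And>t. (F has_vector_derivative G t) (at t)"
    and G_deriv: "\<And>t. (G has_vector_derivative \<rho> t) (at t)"
    and continuous_weight: "continuous_on UNIV \<rho>"
    and nodes: "node_sequence n x"
begin

text \<open>As a difference quotient of \<open>F\<close> this is the mean of \<open>G\<close> over
  the subinterval, and at the same time the slope of the linear interpolant of
  \<open>F\<close>.\<close>

definition mean :: "nat \<Rightarrow> complex" where
  "mean j = (F (x (Suc j)) - F (x j)) /\<^sub>R (x (Suc j) - x j)"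

text \<open>The squared L_2 distance from \<open>G\<close> to the functions that are constant on
  each subinterval, since the mean is the best constant there.\<close>

definition sq_radius :: real where
  "sq_radius = (\<Sum>j\<le>n. integral {x j..x (Suc j)} (\<lambda>t. (cmod (G t - mean j))\<^sup>2))"

text \<open>The part of the integral over one subinterval that the values of \<open>f\<close> at its
  two endpoints determine.\<close>

definition boundary_term :: "(real \<Rightarrow> complex) \<Rightarrow> nat \<Rightarrow> complex" where
  "boundary_term f j = f (x (Suc j)) * (G (x (Suc j)) - mean j) - f (x j) * (G (x j) - mean j)"

lemma node_less: "j \<le> n \<Longrightarrow> x j < x (Suc j)"
  and node_0: "x 0 = 0" and node_Suc: "x (Suc n) = 1"
  using nodes by (auto simp: node_sequence_def)

lemma node_mono: "i \<le> j \<Longrightarrow> j \<le> Suc n \<Longrightarrow> x i \<le> x j"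
proof (induction j)
  case (Suc j)
  then show ?case using node_less[of j] by (cases "i = Suc j") (auto simp: le_Suc_eq)
qed simp

lemma node_bounds: "j \<le> Suc n \<Longrightarrow> 0 \<le> x j" "j \<le> Suc n \<Longrightarrow> x j \<le> 1"
  using node_mono[of 0 j] node_mono[of j "Suc n"] by (auto simp: node_0 node_Suc)

lemma subinterval: "j \<le> n \<Longrightarrow> {x j..x (Suc j)} \<subseteq> {0..1}"
  using node_bounds[of j] node_bounds[of "Suc j"] by auto

lemma has_integral_pieces:
  fixes g :: "real \<Rightarrow> 'a::banach"
  assumes "\<And>j. j \<le> n \<Longrightarrow> (g has_integral I j) {x j..x (Suc j)}"
  shows "(g has_integral (\<Sum>j\<le>n. I j)) {0..1}"
  using has_integral_combine_increasing[of n x g I] assms node_less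
  by (simp add: node_0 node_Suc less_imp_le)

lemma continuous_G: "continuous_on S G"
  using G_deriv has_vector_derivative_continuous
  by (intro continuous_at_imp_continuous_on) blast

lemma deviation_integrable: "(\<lambda>t. (cmod (G t - mean j))\<^sup>2) integrable_on {x j..x (Suc j)}"
  by (intro integrable_continuous_interval continuous_intros continuous_G)

lemma sq_radius_nonneg: "sq_radius \<ge> 0"
  unfolding sq_radius_def by (intro sum_nonneg integral_nonneg deviation_integrable) auto

lemma weighted_integral_eq_pieces:
  assumes f: "f \<in> H10"
  shows "weighted_integral \<rho> f = (\<Sum>j\<le>n. integral {x j..x (Suc j)} (\<lambda>t. f t * \<rho> t))"
    and "j \<le> n \<Longrightarrow> (\<lambda>t. deriv01 f t * (G t - mean j)) integrable_on {x j..x (Suc j)}"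
    and "j \<le> n \<Longrightarrow> integral {x j..x (Suc j)} (\<lambda>t. f t * \<rho> t) =
           boundary_term f j - integral {x j..x (Suc j)} (\<lambda>t. deriv01 f t * (G t - mean j))"
proof -
  have cont: "continuous_on {0..1} (\<lambda>t. f t * \<rho> t)"
    by (intro continuous_intros H10_continuous_on f continuous_on_subset[OF continuous_weight]) auto
  then have "set_integrable lebesgue {0..1} (\<lambda>t. f t * \<rho> t)"
    by (metis absolutely_integrable_continuous_real)
  then have eq: "weighted_integral \<rho> f = integral {0..1} (\<lambda>t. f t * \<rho> t)"
    unfolding weighted_integral_def by (rule set_lebesgue_integral_eq_integral)
  have piece: "(\<lambda>t. f t * \<rho> t) integrable_on {x j..x (Suc j)}" if "j \<le> n" for j
    using continuous_on_subset[OF cont subinterval[OF that]] by (rule integrable_continuous_interval)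
  then show "weighted_integral \<rho> f = (\<Sum>j\<le>n. integral {x j..x (Suc j)} (\<lambda>t. f t * \<rho> t))"
    unfolding eq by (intro integral_unique has_integral_pieces integrable_integral)
  assume j: "j \<le> n"
  have "((\<lambda>t. f t * \<rho> t + deriv01 f t * (G t - mean j)) has_integral boundary_term f j) {x j..x (Suc j)}"
    unfolding boundary_term_def
    using H10_integration_by_parts[OF f _ node_less[OF j] _ G_deriv continuous_weight] node_bounds[of j] node_bounds[of "Suc j"] j
    by auto
  \<comment> \<open>Integrability of the term with the derivative needs no estimate of its own: it
    is the difference of two integrable functions.\<close>
  from has_integral_diff[OF this integrable_integral[OF piece[OF j]]]
  have "((\<lambda>t. deriv01 f t * (G t - mean j)) has_integral
      boundary_term f j - integral {x j..x (Suc j)} (\<lambda>t. f t * \<rho> t)) {x j..x (Suc j)}" by simp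
  then show "(\<lambda>t. deriv01 f t * (G t - mean j)) integrable_on {x j..x (Suc j)}"
    and "integral {x j..x (Suc j)} (\<lambda>t. f t * \<rho> t) =
           boundary_term f j - integral {x j..x (Suc j)} (\<lambda>t. deriv01 f t * (G t - mean j))"
    by (auto simp: has_integral_iff)
qed

text \<open>The pointwise bound \<open>|ab| \<le> (t|a|\<^sup>2 + |b|\<^sup>2/t)/2\<close>, optimised over \<open>t\<close> after integration,
  replaces the Cauchy-Schwarz inequality.\<close>

lemma error_le_radius:
  assumes f: "f \<in> H10_ball"
  shows "cmod (weighted_integral \<rho> f - (\<Sum>j\<le>n. boundary_term f j)) \<le> sqrt sq_radius"
    (is "?E \<le> _")
proof -
  have fH: "f \<in> H10" and norm: "H10_norm f \<le> 1" using f by (auto simp: H10_ball_def)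
  let ?d = "\<lambda>t. (cmod (deriv01 f t))\<^sup>2"
  have int: "set_integrable lebesgue {0..1} ?d"
    using fH by (simp add: H10_def square_integrable_on_def)
  then have d_int: "?d integrable_on {0..1}" and d_eq: "(LINT t:{0..1}|lebesgue. ?d t) = integral {0..1} ?d"
    using set_lebesgue_integral_eq_integral[OF int] by auto
  have d_le: "integral {0..1} ?d \<le> 1"
    using norm by (simp add: H10_norm_def d_eq)
  have piece: "?d integrable_on {x j..x (Suc j)}" if "j \<le> n" for j
    using integrable_on_subinterval[OF d_int subinterval[OF that]] .
  have d_sum: "(\<Sum>j\<le>n. integral {x j..x (Suc j)} ?d) = integral {0..1} ?d"
    by (rule integral_unique[symmetric]) (intro has_integral_pieces integrable_integral piece)
  have bound: "?E \<le> (s + sq_radius / s) / 2" if s: "s > 0" for s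
  proof -
    let ?g = "\<lambda>j t. s / 2 * ?d t + 1 / (2 * s) * (cmod (G t - mean j))\<^sup>2"
    have g: "(?g j has_integral (s / 2 * integral {x j..x (Suc j)} ?d
        + 1 / (2 * s) * integral {x j..x (Suc j)} (\<lambda>t. (cmod (G t - mean j))\<^sup>2))) {x j..x (Suc j)}"
      if "j \<le> n" for j
      by (intro has_integral_add has_integral_mult_right integrable_integral piece[OF that] deviation_integrable)
    have le: "cmod (integral {x j..x (Suc j)} (\<lambda>t. deriv01 f t * (G t - mean j)))
        \<le> integral {x j..x (Suc j)} (?g j)" if j: "j \<le> n" for j
    proof (rule integral_norm_bound_integral)
      fix t
      have "0 \<le> (s * cmod (deriv01 f t) - cmod (G t - mean j))\<^sup>2" by simp
      then show "cmod (deriv01 f t * (G t - mean j)) \<le> ?g j t"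
        using s unfolding norm_mult by (simp add: power2_eq_square field_simps)
    qed (use g[OF j] weighted_integral_eq_pieces(2)[OF fH j] in \<open>auto simp: has_integral_iff\<close>)
    have "weighted_integral \<rho> f - (\<Sum>j\<le>n. boundary_term f j) =
        - (\<Sum>j\<le>n. integral {x j..x (Suc j)} (\<lambda>t. deriv01 f t * (G t - mean j)))"
      using weighted_integral_eq_pieces(1,3)[OF fH] by (simp add: sum_subtractf)
    then have "?E = cmod (\<Sum>j\<le>n. integral {x j..x (Suc j)} (\<lambda>t. deriv01 f t * (G t - mean j)))"
      by (simp only: norm_minus_cancel)
    also have "\<dots> \<le> (\<Sum>j\<le>n. integral {x j..x (Suc j)} (?g j))"
      by (rule order_trans[OF norm_sum sum_mono[OF le]]) simp
    also have "\<dots> = (\<Sum>j\<le>n. s / 2 * integral {x j..x (Suc j)} ?d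
        + 1 / (2 * s) * integral {x j..x (Suc j)} (\<lambda>t. (cmod (G t - mean j))\<^sup>2))"
      using g by (intro sum.cong refl integral_unique) auto
    also have "\<dots> = s / 2 * integral {0..1} ?d + 1 / (2 * s) * sq_radius"
      by (simp only: sum.distrib sum_distrib_left[symmetric] d_sum sq_radius_def)
    also have "\<dots> \<le> s / 2 * 1 + 1 / (2 * s) * sq_radius"
      using s d_le by (intro add_mono mult_left_mono) auto
    finally show ?thesis using s by (simp add: field_simps)
  qed
  show ?thesis
  \<comment> \<open>The best parameter is \<open>s = sqrt sq_radius\<close>. If this is 0 it is not
    admissible, and \<open>s\<close> is taken arbitrarily small instead.\<close>
  proof (cases "sq_radius = 0")
    case True
    have "?E \<le> 0 + e" if "e > 0" for e
      using bound[OF that] that True by simp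
    then show ?thesis using True field_le_epsilon[of ?E 0] by simp
  next
    case False
    then have "sq_radius > 0" using sq_radius_nonneg by simp
    then show ?thesis using bound[of "sqrt sq_radius"] by (simp add: real_div_sqrt)
  qed
qed

section \<open>The extremal function\<close>

text \<open>The clamped difference is the length of the part of the subinterval that lies to the
  left of \<open>t\<close>. Weighted with the slopes, these ramps add up to the piecewise linear
  interpolant of \<open>F\<close> minus \<open>F 0\<close>, in one formula valid on all of
  [0,1].\<close>

definition interpolation_error :: "real \<Rightarrow> complex" where
  "interpolation_error t = F t - F 0 - (\<Sum>j\<le>n. mean j * of_real (min (max t (x j)) (x (Suc j)) - x j))"

text \<open>At a node every ramp is either complete or not yet begun, so the sum telescopes to
  \<open>F (x i) - F (x 0)\<close>.\<close>

lemma interpolation_error_at_node: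
  assumes i: "i \<le> Suc n"
  shows "interpolation_error (x i) = 0"
proof -
  have piece: "mean j * of_real (min (max (x i) (x j)) (x (Suc j)) - x j) =
      (if j < i then F (x (Suc j)) - F (x j) else 0)" if j: "j \<le> n" for j
  proof (cases "j < i")
    case True
    then have "x (Suc j) \<le> x i" using i by (intro node_mono) auto
    then show ?thesis using True node_less[OF j] by (simp add: mean_def scaleR_conv_of_real)
  next
    case False
    then have "x i \<le> x j" using j by (intro node_mono) auto
    then show ?thesis using False node_less[OF j] by simp
  qed
  have "(\<Sum>j\<le>n. mean j * of_real (min (max (x i) (x j)) (x (Suc j)) - x j)) =
      (\<Sum>j\<le>n. if j < i then F (x (Suc j)) - F (x j) else 0)"
    using piece by (intro sum.cong) auto
  also have "\<dots> = (\<Sum>j<i. F (x (Suc j)) - F (x j))"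
    using i by (intro sum.mono_neutral_cong_right) auto
  also have "\<dots> = F (x i) - F (x 0)"
    by (rule sum_lessThan_telescope)
  finally show ?thesis by (simp add: interpolation_error_def node_0)
qed

text \<open>Between \<open>x i\<close> and \<open>t\<close> only the ramp with index
  \<open>i\<close> changes, and at \<open>x i\<close> the error is 0.\<close>

lemma interpolation_error_on_piece:
  assumes i: "i \<le> n" and t: "x i \<le> t" "t \<le> x (Suc i)"
  shows "interpolation_error t = F t - F (x i) - mean i * of_real (t - x i)"
proof -
  have "min (max t (x j)) (x (Suc j)) - x j =
      min (max (x i) (x j)) (x (Suc j)) - x j + (if j = i then t - x i else 0)" if j: "j \<le> n" for j
  proof -
    consider "j < i" | "j = i" | "j > i" by linarith
    then show ?thesis
    proof cases
      case 1
      then have "x (Suc j) \<le> x i" using i by (intro node_mono) auto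
      then show ?thesis using 1 t node_less[OF j] by simp
    next
      case 2
      then show ?thesis using t by simp
    next
      case 3
      then have "x (Suc i) \<le> x j" using j by (intro node_mono) auto
      then show ?thesis using 3 t node_less[OF j] by simp
    qed
  qed
  then have "(\<Sum>j\<le>n. mean j * of_real (min (max t (x j)) (x (Suc j)) - x j)) =
    (\<Sum>j\<le>n. mean j * of_real (min (max (x i) (x j)) (x (Suc j)) - x j) + (if j = i then mean j * of_real (t - x i) else 0))"
    by (intro sum.cong refl) (auto simp: algebra_simps)
  also have "\<dots> = (\<Sum>j\<le>n. mean j * of_real (min (max (x i) (x j)) (x (Suc j)) - x j)) + mean i * of_real (t - x i)"
    using i by (simp add: sum.distrib)
  finally show ?thesis
    using interpolation_error_at_node[of i] i by (simp add: interpolation_error_def algebra_simps)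
qed

lemma interpolation_error_lipschitz:
  obtains B where "B \<ge> 0"
    "\<And>u v. \<lbrakk>u \<in> {0..1}; v \<in> {0..1}; u \<le> v\<rbrakk> \<Longrightarrow> cmod (interpolation_error v - interpolation_error u) \<le> B * (v - u)"
proof -
  obtain B where B: "B \<ge> 0" "\<And>u v. \<lbrakk>u \<in> {0..1}; v \<in> {0..1}; u \<le> v\<rbrakk> \<Longrightarrow> cmod (F v - F u) \<le> B * (v - u)"
    using lipschitz_of_continuous_derivative[OF F_deriv continuous_G] by metis
  let ?c = "\<lambda>j t. min (max t (x j)) (x (Suc j)) - x j"
  show thesis
  proof (rule that[of "B + (\<Sum>j\<le>n. cmod (mean j))"])
    show "B + (\<Sum>j\<le>n. cmod (mean j)) \<ge> 0" using B by (simp add: sum_nonneg)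
    fix u v :: real assume uv: "u \<in> {0..1}" "v \<in> {0..1}" "u \<le> v"
    have eq: "interpolation_error v - interpolation_error u = (F v - F u) - (\<Sum>j\<le>n. mean j * of_real (?c j v - ?c j u))"
      by (simp add: interpolation_error_def sum_subtractf algebra_simps)
    have "cmod (interpolation_error v - interpolation_error u)
        \<le> cmod (F v - F u) + cmod (\<Sum>j\<le>n. mean j * of_real (?c j v - ?c j u))"
      unfolding eq by (rule norm_triangle_ineq4)
    also have "\<dots> \<le> B * (v - u) + (\<Sum>j\<le>n. cmod (mean j) * (v - u))"
    proof (intro add_mono B uv order_trans[OF norm_sum] sum_mono)
      fix j
      have "\<bar>?c j v - ?c j u\<bar> \<le> v - u" using clamp_nonexpansive[OF uv(3), of "x j" "x (Suc j)"] by argo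
      then show "cmod (mean j * of_real (?c j v - ?c j u)) \<le> cmod (mean j) * (v - u)"
        unfolding norm_mult norm_of_real by (intro mult_left_mono) auto
    qed
    finally show "cmod (interpolation_error v - interpolation_error u) \<le> (B + (\<Sum>j\<le>n. cmod (mean j))) * (v - u)"
      by (simp add: algebra_simps sum_distrib_left)
  qed
qed

lemma interpolation_error_deriv:
  assumes i: "i \<le> n" and t: "x i < t" "t < x (Suc i)"
  shows "(interpolation_error has_vector_derivative (G t - mean i)) (at t)"
proof (rule has_vector_derivative_transform_within_open[where S = "{x i<..<x (Suc i)}"])
  have "((\<lambda>t. F t - F (x i) - mean i * of_real (t - x i)) has_vector_derivative (G t - 0 - mean i * of_real (1 - 0))) (at t)"
    by (intro has_vector_derivative_diff has_vector_derivative_const F_deriv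
        has_vector_derivative_mult_right has_vector_derivative_of_real DERIV_diff DERIV_ident DERIV_const)
  then show "((\<lambda>t. F t - F (x i) - mean i * of_real (t - x i)) has_vector_derivative (G t - mean i)) (at t)"
    by simp
qed (use t interpolation_error_on_piece[OF i] in auto)

text \<open>A multiple of the conjugate of the interpolation error has derivative proportional to
  the conjugate of \<open>G - mean j\<close> on each piece, which is the equality case of the error
  bound. The free phase \<sigma> later provides two functions with the same data and opposite
  integrals.\<close>

lemma extremal_function:
  assumes \<sigma>: "cmod \<sigma> = 1"
  obtains f where "f \<in> H10_ball" "\<And>i. i \<le> Suc n \<Longrightarrow> f (x i) = 0"
    "weighted_integral \<rho> f = \<sigma> * of_real (sqrt sq_radius)"
proof (cases "sq_radius = 0")
  case True
  \<comment> \<open>For \<open>sq_radius = 0\<close> there is nothing to normalise by, and the zero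
    function does the job. Its derivative has to be computed only on [0,1], because the indicator
    removes all other points.\<close>
  have d: "deriv01 (\<lambda>_. 0) t = 0" if "t \<in> {0..1}" for t
    unfolding deriv01_def
    using vector_derivative_within_closed_interval[of 0 1 t "\<lambda>_. 0" "0::complex"] that by auto
  have zero: "(\<lambda>t. indicat_real {0..1} t *\<^sub>R deriv01 (\<lambda>_. 0) t) = (\<lambda>_. 0)"
    "(\<lambda>t. indicat_real {0..1} t *\<^sub>R (cmod (deriv01 (\<lambda>_. 0) t))\<^sup>2) = (\<lambda>_. 0)"
    using d by (auto simp: indicator_def)
  have "(\<lambda>_. 0) \<in> H10"
    by (simp add: H10_def absolutely_continuous_on_lipschitz[where B = 0] square_integrable_on_def
        set_borel_measurable_def set_integrable_def zero del: real_scaleR_def)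
  moreover have "H10_norm (\<lambda>_. 0) = 0"
    by (simp add: H10_norm_def set_lebesgue_integral_def zero del: real_scaleR_def)
  ultimately show thesis
    using True by (intro that[of "\<lambda>_. 0"]) (auto simp: H10_ball_def weighted_integral_def set_lebesgue_integral_def)
next
  case False
  define r where "r = sqrt sq_radius"
  have r: "r > 0" "r * r = sq_radius" using False sq_radius_nonneg by (auto simp: r_def)
  \<comment> \<open>Division by \<open>r\<close> makes the norm 1; the minus sign cancels the one
    from integration by parts.\<close>
  define f where "f t = - \<sigma> * (cnj (interpolation_error t) /\<^sub>R r)" for t
  obtain B where B: "B \<ge> 0"
    "\<And>u v. \<lbrakk>u \<in> {0..1}; v \<in> {0..1}; u \<le> v\<rbrakk> \<Longrightarrow> cmod (interpolation_error v - interpolation_error u) \<le> B * (v - u)"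
    by (rule interpolation_error_lipschitz) (rule that)
  have ac: "absolutely_continuous_on {0..1} f"
  proof (rule absolutely_continuous_on_lipschitz[where B = "B / r"])
    fix u v :: real assume uv: "u \<in> {0..1}" "v \<in> {0..1}" "u \<le> v"
    have "f v - f u = - \<sigma> * (cnj (interpolation_error v - interpolation_error u) /\<^sub>R r)"
      by (simp add: f_def scaleR_diff_right algebra_simps)
    also have "cmod \<dots> = cmod (interpolation_error v - interpolation_error u) / r"
      using r \<sigma> unfolding norm_mult norm_scaleR complex_mod_cnj by (simp add: divide_inverse mult.commute)
    also have "\<dots> \<le> B * (v - u) / r" using B(2)[OF uv] r by (intro divide_right_mono) auto
    finally show "cmod (f v - f u) \<le> B / r * (v - u)" by simp
  qed (use B r in auto)
  have der: "(f has_vector_derivative - \<sigma> * (cnj (G t - mean i) /\<^sub>R r)) (at t)"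
    if "i \<le> n" "x i < t" "t < x (Suc i)" for i t
    unfolding f_def
    by (intro has_vector_derivative_mult_right bounded_linear.has_vector_derivative[OF bounded_linear_scaleR_right]
        has_vector_derivative_cnj interpolation_error_deriv that)
  \<comment> \<open>The nodes are the only points where the derivative may fail to have the expected
    form; being finitely many, they affect no integral.\<close>
  define N where "N = x ` {..Suc n}"
  have N: "finite N" by (simp add: N_def)
  have inner: "\<exists>i\<le>n. x i < t \<and> t < x (Suc i)" if t: "t \<in> {0..1}" "t \<notin> N" for t
  proof -
    obtain i where i: "i \<le> n" "x i \<le> t" "t \<le> x (Suc i)"
      using interval_of_increasing[of x t n] t by (auto simp: node_0 node_Suc)
    moreover have "t \<noteq> x i" "t \<noteq> x (Suc i)" using t(2) i(1) by (auto simp: N_def)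
    ultimately show ?thesis by force
  qed
  have deriv: "deriv01 f t = - \<sigma> * (cnj (G t - mean i) /\<^sub>R r)"
    if i: "i \<le> n" and t: "t \<in> {x i..x (Suc i)} - {x i, x (Suc i)}" for i t
  proof -
    have "x i < t" "t < x (Suc i)" "t \<in> {0..1}"
      using t subsetD[OF subinterval[OF i], of t] by auto
    then show ?thesis
      unfolding deriv01_def
      using has_vector_derivative_at_within[OF der[OF i]]
      by (intro vector_derivative_within_closed_interval) auto
  qed
  have "AE t in lebesgue. t \<notin> N"
    using N by (intro AE_not_in) (simp add: negligible_iff_null_sets[symmetric] negligible_finite)
  then have AE: "AE t\<in>{0..1} in lebesgue. f differentiable (at t within {0..1})"
  proof (rule AE_mp, intro AE_I2 impI)
    fix t assume "t \<notin> N" "t \<in> {0..1}"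
    then obtain i where "i \<le> n" "x i < t" "t < x (Suc i)" using inner by blast
    then show "f differentiable (at t within {0..1})"
      using der by (meson differentiableI_vector differentiable_at_withinI)
  qed
  have d_piece: "((\<lambda>t. deriv01 f t) has_integral integral {x i..x (Suc i)} (\<lambda>t. - \<sigma> * (cnj (G t - mean i) /\<^sub>R r))) {x i..x (Suc i)}"
    if i: "i \<le> n" for i
  proof (rule has_integral_spike_finite[where S = "{x i, x (Suc i)}"])
    show "((\<lambda>t. - \<sigma> * (cnj (G t - mean i) /\<^sub>R r)) has_integral integral {x i..x (Suc i)} (\<lambda>t. - \<sigma> * (cnj (G t - mean i) /\<^sub>R r))) {x i..x (Suc i)}"
      by (intro integrable_integral integrable_continuous_interval continuous_intros continuous_G)
  qed (use deriv[OF i] in auto)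
  \<comment> \<open>Integrability is used here as the way to Lebesgue measurability of the
    derivative.\<close>
  from has_integral_pieces[OF this] have "deriv01 f integrable_on {0..1}"
    by (rule has_integral_integrable)
  then have meas: "set_borel_measurable lebesgue {0..1} (deriv01 f)"
    using integrable_imp_measurable[of "deriv01 f" "{0..1}"]
    by (simp add: set_borel_measurable_def borel_measurable_restrict_space_iff)
  let ?q = "\<lambda>i. integral {x i..x (Suc i)} (\<lambda>t. (cmod (G t - mean i))\<^sup>2)"
  have sq_piece: "((\<lambda>t. (cmod (deriv01 f t))\<^sup>2) has_integral ?q i / r\<^sup>2) {x i..x (Suc i)}"
    if i: "i \<le> n" for i
  proof (rule has_integral_spike_finite[where S = "{x i, x (Suc i)}"])
    show "((\<lambda>t. (cmod (G t - mean i))\<^sup>2 / r\<^sup>2) has_integral ?q i / r\<^sup>2) {x i..x (Suc i)}"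
      by (intro has_integral_divide integrable_integral deviation_integrable)
    show "(cmod (deriv01 f t))\<^sup>2 = (cmod (G t - mean i))\<^sup>2 / r\<^sup>2"
      if "t \<in> {x i..x (Suc i)} - {x i, x (Suc i)}" for t
      unfolding deriv[OF i that] norm_mult norm_scaleR complex_mod_cnj using \<sigma> by (simp add: power_mult_distrib field_simps)
  qed simp
  have sq: "((\<lambda>t. (cmod (deriv01 f t))\<^sup>2) has_integral 1) {0..1}"
  proof -
    have "(\<Sum>i\<le>n. ?q i / r\<^sup>2) = sq_radius / r\<^sup>2"
      unfolding sq_radius_def sum_divide_distrib ..
    also have "\<dots> = 1" using r False by (simp add: power2_eq_square)
    finally show ?thesis using has_integral_pieces[OF sq_piece] by simp
  qed
  then have sq_int: "set_integrable lebesgue {0..1} (\<lambda>t. (cmod (deriv01 f t))\<^sup>2)"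
    by (intro nonnegative_absolutely_integrable_1) auto
  have node: "f (x i) = 0" if "i \<le> Suc n" for i
    using interpolation_error_at_node[OF that] by (simp add: f_def)
  have H: "f \<in> H10"
    using ac AE meas sq_int node[of 0] node[of "Suc n"]
    by (auto simp: H10_def square_integrable_on_def node_0 node_Suc)
  have "H10_norm f = 1"
    unfolding H10_norm_def set_lebesgue_integral_eq_integral(2)[OF sq_int] using integral_unique[OF sq] by simp
  then have ball: "f \<in> H10_ball" using H by (simp add: H10_ball_def)
  have "integral {x i..x (Suc i)} (\<lambda>t. f t * \<rho> t) = \<sigma> * of_real (?q i / r)" if i: "i \<le> n" for i
  proof -
    have "((\<lambda>t. deriv01 f t * (G t - mean i)) has_integral - \<sigma> * of_real (?q i / r)) {x i..x (Suc i)}"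
    proof (rule has_integral_spike_finite[where S = "{x i, x (Suc i)}"])
      show "((\<lambda>t. - \<sigma> * of_real ((cmod (G t - mean i))\<^sup>2 / r)) has_integral - \<sigma> * of_real (?q i / r)) {x i..x (Suc i)}"
        by (intro has_integral_mult_right has_integral_of_real has_integral_divide integrable_integral deviation_integrable)
      show "deriv01 f t * (G t - mean i) = - \<sigma> * of_real ((cmod (G t - mean i))\<^sup>2 / r)"
        if "t \<in> {x i..x (Suc i)} - {x i, x (Suc i)}" for t
        unfolding deriv[OF i that] of_real_divide complex_norm_square by (simp add: scaleR_conv_of_real divide_inverse mult_ac)
    qed simp
    moreover have "boundary_term f i = 0" using node i by (simp add: boundary_term_def)
    ultimately show ?thesis
      using weighted_integral_eq_pieces(3)[OF H i] by (simp add: integral_unique)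
  qed
  then have "weighted_integral \<rho> f = \<sigma> * of_real (\<Sum>i\<le>n. ?q i / r)"
    by (simp add: weighted_integral_eq_pieces(1)[OF H] sum_distrib_left)
  also have "(\<Sum>i\<le>n. ?q i / r) = sq_radius / r"
    unfolding sq_radius_def sum_divide_distrib ..
  also have "\<dots> = r"
    using r by (simp add: field_simps)
  finally show thesis using that[OF ball node] by (simp add: r_def)
qed

section \<open>Radius of information and optimal algorithms\<close>

text \<open>A function in the ball with zero data also vanishes at 0 and 1, so all boundary terms
  drop out of the error bound. The extremal function attains the bound.\<close>

lemma radius_of_node_information:
  "radius_of_information (weighted_integral \<rho>) (node_information n x) = ereal (sqrt sq_radius)"
  unfolding radius_of_information_def
proof (rule antisym)
  show "(SUP f\<in>{f \<in> H10_ball. \<forall>y\<in>set (node_information n x f). y = 0}. ereal (cmod (weighted_integral \<rho> f)))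
      \<le> ereal (sqrt sq_radius)"
  proof (rule SUP_least)
    fix f assume f: "f \<in> {f \<in> H10_ball. \<forall>y\<in>set (node_information n x f). y = 0}"
    have zero: "f (x j) = 0" if j: "j \<le> Suc n" for j
    proof (cases "j = 0 \<or> j = Suc n")
      case True
      then show ?thesis using f by (auto simp: H10_ball_def H10_def node_0 node_Suc)
    next
      case False
      then have "f (x j) \<in> set (node_information n x f)"
        using j by (auto simp: node_information_def simp del: upt_Suc)
      then show ?thesis using f by blast
    qed
    have "boundary_term f j = 0" if "j \<le> n" for j
      using zero that by (simp add: boundary_term_def)
    then show "ereal (cmod (weighted_integral \<rho> f)) \<le> ereal (sqrt sq_radius)"
      using error_le_radius[of f] f by simp
  qed
  obtain f where f: "f \<in> H10_ball" "\<And>i. i \<le> Suc n \<Longrightarrow> f (x i) = 0"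
    "weighted_integral \<rho> f = 1 * of_real (sqrt sq_radius)"
    by (rule extremal_function[of 1]) (simp, rule that)
  have "sqrt sq_radius = cmod (weighted_integral \<rho> f)"
    using f(3) sq_radius_nonneg by simp
  also have "ereal \<dots> \<le> (SUP f\<in>{f \<in> H10_ball. \<forall>y\<in>set (node_information n x f). y = 0}. ereal (cmod (weighted_integral \<rho> f)))"
    by (rule SUP_upper) (use f in \<open>auto simp: node_information_def\<close>)
  finally show "ereal (sqrt sq_radius) \<le>
    (SUP f\<in>{f \<in> H10_ball. \<forall>y\<in>set (node_information n x f). y = 0}. ereal (cmod (weighted_integral \<rho> f)))" .
qed

text \<open>The extremal functions for the phases 1 and -1 both give zero data, so the algorithm
  returns the same value \<open>a\<close> for both. Their integrals are
  \<open>2 * sqrt sq_radius\<close> apart, hence \<open>a\<close> misses one of them by at least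
  half of that.\<close>

lemma radius_le_worst_case_error:
  assumes xs: "set xs \<subseteq> x ` {..Suc n}"
  shows "ereal (sqrt sq_radius) \<le> worst_case_error (weighted_integral \<rho>) (\<lambda>f. \<phi> (map f xs))"
proof -
  let ?r = "complex_of_real (sqrt sq_radius)"
  define a where "a = \<phi> (map (\<lambda>_. 0) xs)"
  have bound: "ereal (cmod (\<sigma> * ?r - a)) \<le> worst_case_error (weighted_integral \<rho>) (\<lambda>f. \<phi> (map f xs))"
    if \<sigma>: "cmod \<sigma> = 1" for \<sigma>
  proof -
    obtain f where f: "f \<in> H10_ball" "\<And>i. i \<le> Suc n \<Longrightarrow> f (x i) = 0" "weighted_integral \<rho> f = \<sigma> * ?r"
      by (rule extremal_function[OF \<sigma>]) (rule that)
    have "map f xs = map (\<lambda>_. 0) xs" using f(2) xs by auto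
    then have "cmod (\<sigma> * ?r - a) = cmod (weighted_integral \<rho> f - \<phi> (map f xs))"
      by (simp only: a_def f(3))
    also have "ereal \<dots> \<le> worst_case_error (weighted_integral \<rho>) (\<lambda>f. \<phi> (map f xs))"
      unfolding worst_case_error_def using f(1) by (rule SUP_upper)
    finally show ?thesis .
  qed
  have "2 * sqrt sq_radius = cmod (?r + ?r)"
    using sq_radius_nonneg by (simp flip: of_real_add)
  also have "?r + ?r = (1 * ?r - a) - (- 1 * ?r - a)" by simp
  also have "cmod \<dots> \<le> cmod (1 * ?r - a) + cmod (- 1 * ?r - a)"
    by (rule norm_triangle_ineq4)
  finally consider "sqrt sq_radius \<le> cmod (1 * ?r - a)" | "sqrt sq_radius \<le> cmod (- 1 * ?r - a)"
    by linarith
  then show ?thesis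
  proof cases
    case 1
    show ?thesis by (rule order_trans[OF _ bound[of 1]]) (use 1 in simp_all)
  next
    case 2
    show ?thesis by (rule order_trans[OF _ bound[of "- 1"]]) (use 2 in simp_all)
  qed
qed

text \<open>The algorithm is the sum of the boundary terms, which is computable from the
  samples.\<close>

lemma sampling_algorithm_attaining_radius:
  "\<exists>A\<in>sampling_algorithms n. worst_case_error (weighted_integral \<rho>) A \<le> ereal (sqrt sq_radius)"
proof -
  \<comment> \<open>Samples are taken at inner nodes only, so the value at \<open>x j\<close> stands
    at list position \<open>j - 1\<close>; the endpoint values are 0 for every function in
    \<open>H10\<close>.\<close>
  define v where "v ys j = (if j = 0 \<or> j = Suc n then 0 else ys ! (j - 1) :: complex)" for ys j
  define \<phi> where "\<phi> ys = (\<Sum>j\<le>n. v ys (Suc j) * (G (x (Suc j)) - mean j) - v ys j * (G (x j) - mean j))" for ys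
  define xs where "xs = map x [1..<Suc n]"
  have "(\<lambda>f. \<phi> (map f xs)) \<in> sampling_algorithms n"
    unfolding sampling_algorithms_def
  proof (intro CollectI exI conjI)
    show "length xs \<le> n" by (simp add: xs_def)
    show "set xs \<subseteq> {0..1}" using node_bounds by (auto simp: xs_def simp del: upt_Suc)
  qed simp
  moreover have "worst_case_error (weighted_integral \<rho>) (\<lambda>f. \<phi> (map f xs)) \<le> ereal (sqrt sq_radius)"
    unfolding worst_case_error_def
  proof (rule SUP_least)
    fix f assume f: "f \<in> H10_ball"
    have "v (map f xs) j = f (x j)" if "j \<le> Suc n" for j
    proof (cases "j = 0 \<or> j = Suc n")
      case True
      then show ?thesis using f by (auto simp: v_def H10_ball_def H10_def node_0 node_Suc)
    next
      case False
      then have "j - 1 < n" "1 + (j - 1) = j" using that by auto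
      then show ?thesis using False by (simp add: v_def xs_def del: upt_Suc)
    qed
    then have "\<phi> (map f xs) = (\<Sum>j\<le>n. boundary_term f j)"
      unfolding \<phi>_def boundary_term_def by (intro sum.cong) auto
    then show "ereal (cmod (weighted_integral \<rho> f - \<phi> (map f xs))) \<le> ereal (sqrt sq_radius)"
      using error_le_radius[OF f] by simp
  qed
  ultimately show ?thesis by blast
qed

end

section \<open>The oscillatory weight\<close>

text \<open>The factor is the reciprocal of \<open>- 2 * pi * \<i> * k\<close>. Without an added
  constant the antiderivative has constant modulus, which makes the squared deviation from the mean
  explicit.\<close>

definition osc_antideriv :: "real \<Rightarrow> real \<Rightarrow> complex" where
  "osc_antideriv k t = osc_weight k t * (\<i> / of_real (2 * pi * k))"

definition osc_antideriv2 :: "real \<Rightarrow> real \<Rightarrow> complex" where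
  "osc_antideriv2 k t = osc_weight k t * of_real (- 1 / (2 * pi * k)\<^sup>2)"

lemma osc_weight_eq_cis: "osc_weight k t = cis (- (2 * pi * k * t))"
  by (simp add: osc_weight_def cis_conv_exp algebra_simps)

lemma osc_weight_has_vector_derivative:
  "(osc_weight k has_vector_derivative osc_weight k t * (- \<i> * of_real (2 * pi * k))) (at t)"
proof -
  have eq: "osc_weight k = (\<lambda>t. exp (t *\<^sub>R (- \<i> * of_real (2 * pi * k))))"
    by (simp add: osc_weight_def fun_eq_iff scaleR_conv_of_real algebra_simps)
  show ?thesis unfolding eq by (rule exp_scaleR_has_vector_derivative_right)
qed

lemma osc_information_nodes:
  assumes "k \<noteq> 0" "node_sequence n x"
  shows "information_nodes (osc_weight k) (osc_antideriv k) (osc_antideriv2 k) n x"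
proof
  have der: "((\<lambda>t. osc_weight k t * a) has_vector_derivative osc_weight k t * (- \<i> * of_real (2 * pi * k)) * a) (at t)" for a t
    by (intro has_vector_derivative_mult_left osc_weight_has_vector_derivative)
  show "(osc_antideriv2 k has_vector_derivative osc_antideriv k t) (at t)" for t
    using der[of "of_real (- 1 / (2 * pi * k)\<^sup>2)" t] assms(1)
    by (simp add: osc_antideriv_def osc_antideriv2_def[abs_def] power2_eq_square mult_ac)
  show "(osc_antideriv k has_vector_derivative osc_weight k t) (at t)" for t
    using der[of "\<i> / of_real (2 * pi * k)" t] assms(1)
    by (simp add: osc_antideriv_def[abs_def] mult_ac)
  show "continuous_on UNIV (osc_weight k)"
    unfolding osc_weight_def by (intro continuous_intros)
qed (rule assms)

lemma cmod_osc_antideriv: "cmod (osc_antideriv k t) = 1 / \<bar>2 * pi * k\<bar>"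
  by (simp add: osc_antideriv_def osc_weight_eq_cis norm_mult norm_divide abs_mult)

lemma cmod_cis_diff_sq: "(cmod (cis u - cis v))\<^sup>2 = 4 * (sin ((u - v) / 2))\<^sup>2"
proof -
  have "(cmod (cis u - cis v))\<^sup>2 = 2 - 2 * cos (u - v)"
    using sin_cos_squared_add[of u] sin_cos_squared_add[of v]
    by (simp add: cmod_power2 cos_diff power2_diff algebra_simps)
  also have "\<dots> = 4 * (sin ((u - v) / 2))\<^sup>2"
  proof -
    have half: "2 * ((u - v) / 2) = u - v" by simp
    show ?thesis using cos_double_sin[of "(u - v) / 2"] unfolding half by simp
  qed
  finally show ?thesis .
qed

lemma cmod_osc_antideriv2_diff_sq:
  "(cmod (osc_antideriv2 k b - osc_antideriv2 k a))\<^sup>2 = 4 * (sin (pi * k * (b - a)))\<^sup>2 / (2 * pi * k) ^ 4"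
proof -
  have "osc_antideriv2 k b - osc_antideriv2 k a =
      (cis (- (2 * pi * k * b)) - cis (- (2 * pi * k * a))) * of_real (- 1 / (2 * pi * k)\<^sup>2)"
    by (simp only: osc_antideriv2_def osc_weight_eq_cis left_diff_distrib)
  then have "(cmod (osc_antideriv2 k b - osc_antideriv2 k a))\<^sup>2 =
      4 * (sin ((- (2 * pi * k * b) - - (2 * pi * k * a)) / 2))\<^sup>2 * (- 1 / (2 * pi * k)\<^sup>2)\<^sup>2"
    by (simp only: norm_mult power_mult_distrib cmod_cis_diff_sq norm_of_real power2_abs)
  also have "(- (2 * pi * k * b) - - (2 * pi * k * a)) / 2 = - (pi * k * (b - a))"
    by (simp add: field_simps)
  also have "4 * (sin (- (pi * k * (b - a))))\<^sup>2 * (- 1 / (2 * pi * k)\<^sup>2)\<^sup>2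
      = 4 * (sin (pi * k * (b - a)))\<^sup>2 / (2 * pi * k) ^ 4"
    by (simp only: sin_minus power2_minus power_divide power_mult[symmetric]) simp
  finally show ?thesis .
qed

text \<open>The variance identity: the mean of the squared deviation is the mean of
  \<open>|G|\<close> squared, here constant, minus the squared modulus of the mean
  \<open>c\<close>.\<close>

lemma deviation_from_mean_integral:
  fixes F G :: "real \<Rightarrow> complex" and a b B :: real
  defines "c \<equiv> (F b - F a) /\<^sub>R (b - a)"
  assumes "a < b" and F: "\<And>t. (F has_vector_derivative G t) (at t)" and G: "\<And>t. cmod (G t) = B"
  shows "((\<lambda>t. (cmod (G t - c))\<^sup>2) has_integral (b - a) * B\<^sup>2 - (cmod (F b - F a))\<^sup>2 / (b - a)) {a..b}"
proof -
  have expand: "(cmod (G t - c))\<^sup>2 = (B\<^sup>2 + (cmod c)\<^sup>2) - 2 * Re (cnj c * G t)" for t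
  proof -
    have "(cmod (G t - c))\<^sup>2 = (cmod (G t))\<^sup>2 + (cmod c)\<^sup>2 - 2 * Re (cnj c * G t)"
      unfolding cmod_power2 by (simp add: power2_eq_square algebra_simps)
    then show ?thesis by (simp add: G)
  qed
  \<comment> \<open>An antiderivative of the expanded square; its mixed term is available because
    \<open>F\<close> is an antiderivative of \<open>G\<close>.\<close>
  let ?P = "\<lambda>t. (B\<^sup>2 + (cmod c)\<^sup>2) * t - 2 * Re (cnj c * F t)"
  have "((\<lambda>t. (cmod (G t - c))\<^sup>2) has_integral ?P b - ?P a) {a..b}"
    unfolding expand
  proof (rule fundamental_theorem_of_calculus)
    fix t
    have "((\<lambda>t. (B\<^sup>2 + (cmod c)\<^sup>2) * t - 2 * Re (cnj c * F t)) has_vector_derivative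
        (B\<^sup>2 + (cmod c)\<^sup>2) * 1 - 2 * Re (cnj c * G t)) (at t)"
      by (intro has_vector_derivative_diff has_vector_derivative_mult_right has_vector_derivative_id
          bounded_linear.has_vector_derivative[OF bounded_linear_Re] F)
    then show "(?P has_vector_derivative (B\<^sup>2 + (cmod c)\<^sup>2) - 2 * Re (cnj c * G t)) (at t within {a..b})"
      by (simp add: has_vector_derivative_at_within)
  qed (use \<open>a < b\<close> in simp)
  moreover have "?P b - ?P a = (b - a) * B\<^sup>2 - (cmod (F b - F a))\<^sup>2 / (b - a)"
  proof -
    have cF: "F b - F a = c * of_real (b - a)"
      using \<open>a < b\<close> by (simp add: c_def scaleR_conv_of_real)
    have "?P b - ?P a = (B\<^sup>2 + (cmod c)\<^sup>2) * (b - a) - 2 * Re (cnj c * (F b - F a))"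
      by (simp add: algebra_simps)
    also have "cnj c * (F b - F a) = of_real ((cmod c)\<^sup>2 * (b - a))"
      unfolding cF of_real_mult complex_norm_square by (simp only: mult_ac)
    also have "(B\<^sup>2 + (cmod c)\<^sup>2) * (b - a) - 2 * Re (of_real ((cmod c)\<^sup>2 * (b - a))) =
        (b - a) * B\<^sup>2 - (cmod c)\<^sup>2 * (b - a)"
      by (simp only: Re_complex_of_real) (simp add: algebra_simps)
    also have "(cmod c)\<^sup>2 * (b - a) = (cmod (F b - F a))\<^sup>2 / (b - a)"
      using \<open>a < b\<close> unfolding cF norm_mult norm_of_real by (simp add: power2_eq_square)
    finally show ?thesis .
  qed
  ultimately show ?thesis by simp
qed

text \<open>The variance identity is summed over the pieces; the leading 1 is the total length of
  the subintervals.\<close>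

lemma osc_sq_radius:
  assumes k: "k \<noteq> 0" and x: "node_sequence n x"
  shows "information_nodes.sq_radius (osc_antideriv k) (osc_antideriv2 k) n x =
    (1 / (2 * pi * \<bar>k\<bar>))\<^sup>2 * (1 - 1 / (k\<^sup>2 * pi\<^sup>2) * (\<Sum>j\<le>n. (sin (pi * k * (x (Suc j) - x j)))\<^sup>2 / (x (Suc j) - x j)))"
proof -
  interpret information_nodes "osc_weight k" "osc_antideriv k" "osc_antideriv2 k" n x
    using assms by (rule osc_information_nodes)
  let ?L = "\<lambda>j. x (Suc j) - x j"
  let ?s = "\<lambda>j. (sin (pi * k * ?L j))\<^sup>2 / ?L j"
  have "integral {x j..x (Suc j)} (\<lambda>t. (cmod (osc_antideriv k t - mean j))\<^sup>2) =
      (1 / (2 * pi * \<bar>k\<bar>))\<^sup>2 * (?L j - 1 / (k\<^sup>2 * pi\<^sup>2) * ?s j)" if j: "j \<le> n" for j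
  proof -
    have "integral {x j..x (Suc j)} (\<lambda>t. (cmod (osc_antideriv k t - mean j))\<^sup>2) =
      ?L j * (1 / \<bar>2 * pi * k\<bar>)\<^sup>2 - (4 * (sin (pi * k * ?L j))\<^sup>2 / (2 * pi * k) ^ 4) / ?L j"
      unfolding mean_def cmod_osc_antideriv2_diff_sq[symmetric]
      by (intro integral_unique deviation_from_mean_integral node_less[OF j] F_deriv cmod_osc_antideriv)
    also have "(2 * pi * k) ^ 4 = 4 * (2 * pi * k)\<^sup>2 * (k\<^sup>2 * pi\<^sup>2)"
      by (simp add: power2_eq_square power4_eq_xxxx)
    also have "?L j * (1 / \<bar>2 * pi * k\<bar>)\<^sup>2 - (4 * (sin (pi * k * ?L j))\<^sup>2 / (4 * (2 * pi * k)\<^sup>2 * (k\<^sup>2 * pi\<^sup>2))) / ?L j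
        = (1 / (2 * pi * \<bar>k\<bar>))\<^sup>2 * (?L j - 1 / (k\<^sup>2 * pi\<^sup>2) * ?s j)"
    proof -
      have inv: "(1 / \<bar>2 * pi * k\<bar>)\<^sup>2 = 1 / (2 * pi * k)\<^sup>2" "(1 / (2 * pi * \<bar>k\<bar>))\<^sup>2 = 1 / (2 * pi * k)\<^sup>2"
        by (simp_all add: power_divide power_mult_distrib)
      have "l * (1 / W) - (4 * s / (4 * W * K)) / l = 1 / W * (l - 1 / K * (s / l))"
        if "l > 0" "W > 0" "K > 0" for l s W K :: real
        using that by (simp add: field_simps)
      then show ?thesis unfolding inv using k node_less[OF j] by simp
    qed
    finally show ?thesis .
  qed
  then have "sq_radius = (\<Sum>j\<le>n. (1 / (2 * pi * \<bar>k\<bar>))\<^sup>2 * (?L j - 1 / (k\<^sup>2 * pi\<^sup>2) * ?s j))"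
    unfolding sq_radius_def by (intro sum.cong) auto
  also have "\<dots> = (1 / (2 * pi * \<bar>k\<bar>))\<^sup>2 * ((\<Sum>j\<le>n. ?L j) - 1 / (k\<^sup>2 * pi\<^sup>2) * (\<Sum>j\<le>n. ?s j))"
    by (simp only: sum_distrib_left[symmetric] sum_subtractf)
  also have "(\<Sum>j\<le>n. ?L j) = 1"
    using sum_lessThan_telescope[of x "Suc n"] by (simp add: node_0 node_Suc lessThan_Suc_atMost)
  finally show ?thesis .
qed

lemma sqrt_osc_sq_radius:
  assumes "k \<noteq> 0" "node_sequence n x"
  shows "sqrt (information_nodes.sq_radius (osc_antideriv k) (osc_antideriv2 k) n x) =
    1 / (2 * pi * \<bar>k\<bar>) * sqrt (1 - 1 / (k\<^sup>2 * pi\<^sup>2) * (\<Sum>j\<le>n. (sin (pi * k * (x (Suc j) - x j)))\<^sup>2 / (x (Suc j) - x j)))"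
  unfolding osc_sq_radius[OF assms] real_sqrt_mult by (simp add: abs_mult)

section \<open>Optimality of equidistant nodes\<close>

text \<open>The expression is \<open>u ^ 3\<close> times the second derivative of
  \<open>(1 - cos u) / u\<close>, so its sign gives concavity up to \<open>pi\<close>. It vanishes
  at 0 and its own derivative collapses to \<open>- (u\<^sup>2 * sin u)\<close>.\<close>

lemma one_minus_cos_div_second_deriv_nonpos:
  fixes u :: real
  assumes "0 \<le> u" "u \<le> pi"
  shows "u\<^sup>2 * cos u - 2 * u * sin u + 2 * (1 - cos u) \<le> 0"
proof -
  let ?q = "\<lambda>u::real. u\<^sup>2 * cos u - 2 * u * sin u + 2 * (1 - cos u)"
  have "?q u \<le> ?q 0"
  proof (rule DERIV_nonpos_imp_nonincreasing[OF assms(1)])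
    fix v assume v: "0 \<le> v" "v \<le> u"
    have "(?q has_real_derivative - (v\<^sup>2 * sin v)) (at v)"
      by (auto intro!: derivative_eq_intros simp: algebra_simps power2_eq_square)
    moreover have "- (v\<^sup>2 * sin v) \<le> 0" using v assms by (simp add: sin_ge_zero)
    ultimately show "\<exists>y. (?q has_real_derivative y) (at v) \<and> y \<le> 0" by blast
  qed
  then show ?thesis by simp
qed

text \<open>The maximiser of \<open>(1 - cos u) / u\<close> is \<open>2.3311\<dots>\<close>, only slightly above
  \<open>20 * pi / 27 = 2.3271\<dots>\<close>; this is where the constant \<open>2.7\<close> comes from.\<close>

lemma one_minus_cos_div_deriv_nonneg_at_bound: "1 - cos (20 * pi / 27) \<le> 20 * pi / 27 * sin (20 * pi / 27)"
proof -
  \<comment> \<open>Chosen so that \<open>20 * pi / 27 = pi - 2 * z\<close>. Double angle formulas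
    then reduce the claim to \<open>cos z \<le> 20 * pi / 27 * sin z\<close>, where about 0.918 has
    to stay below about 0.921.\<close>
  define z where "z = 7 * pi / 54"
  have z: "z \<ge> 0.40724" "z \<le> 0.5" using pi_approx by (auto simp: z_def)
  have sin_lower: "sin y \<ge> y - y ^ 3 / 6 - y ^ 5 / 120" if "y \<ge> 0" for y :: real
  proof -
    have "sin_coeff 0 = 0" "sin_coeff 1 = 1" "sin_coeff 2 = 0" "sin_coeff 3 = - 1 / 6" "sin_coeff 4 = 0"
      by (simp_all add: sin_coeff_def fact_numeral)
    then have sum: "(\<Sum>m<5. sin_coeff m * y ^ m) = y - y ^ 3 / 6"
      by (simp add: lessThan_nat_numeral lessThan_Suc)
    have "\<bar>sin y - (y - y ^ 3 / 6)\<bar> \<le> inverse (fact 5) * y ^ 5"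
      using Maclaurin_sin_bound[of y 5] that unfolding sum by simp
    also have "inverse (fact 5) * y ^ 5 = y ^ 5 / 120" by (simp add: fact_numeral)
    finally show ?thesis by linarith
  qed
  have "sin z \<ge> sin 0.40724" using z pi_gt3 by (intro sin_monotone_2pi_le) auto
  then have s: "sin z \<ge> 0.3958" using sin_lower[of "0.40724"] by (simp add: eval_nat_numeral)
  \<comment> \<open>The upper bound for \<open>cos z\<close> comes from a lower bound for the sine
    of the half angle, so the one Taylor estimate serves for both.\<close>
  have "sin (z / 2) \<ge> sin 0.20362" using z pi_gt3 by (intro sin_monotone_2pi_le) auto
  then have "sin (z / 2) \<ge> 0.2021" using sin_lower[of "0.20362"] by (simp add: eval_nat_numeral)
  then have "(0.2021)\<^sup>2 \<le> (sin (z / 2))\<^sup>2" by (intro power_mono) auto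
  then have c: "cos z \<le> 0.9184" using cos_double_sin[of "z / 2"] by (simp add: power2_eq_square)
  have c0: "cos z \<ge> 0" using z pi_gt3 by (intro cos_ge_zero) auto
  have "2.327 * 0.3958 \<le> 20 * pi / 27 * sin z"
    using s pi_approx by (intro mult_mono) auto
  then have "cos z \<le> 20 * pi / 27 * sin z" using c by simp
  then have main: "cos z * cos z \<le> cos z * (20 * pi / 27 * sin z)" using c0 by (rule mult_left_mono)
  have eq: "20 * pi / 27 = pi - 2 * z" by (simp add: z_def)
  have "sin (20 * pi / 27) = 2 * sin z * cos z" "cos (20 * pi / 27) = 1 - 2 * (cos z)\<^sup>2"
    unfolding eq by (simp_all add: sin_double cos_double_cos)
  then show ?thesis using main by (simp add: power2_eq_square algebra_simps)
qed

text \<open>The claim is that \<open>u * sin u + cos u\<close> is at least 1. Its derivative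
  \<open>u * cos u\<close> changes sign at \<open>pi / 2\<close>, so the function first rises from
  the value 1 and then falls, and only the right endpoint needs a numerical check.\<close>

lemma one_minus_cos_div_deriv_nonneg:
  fixes u :: real
  assumes "0 \<le> u" "u \<le> 20 * pi / 27"
  shows "1 - cos u \<le> u * sin u"
proof -
  let ?s = "\<lambda>u::real. u * sin u + cos u"
  have der: "(?s has_real_derivative v * cos v) (at v)" for v
    by (auto intro!: derivative_eq_intros)
  show ?thesis
  proof (cases "u \<le> pi / 2")
    case True
    have "?s 0 \<le> ?s u"
    proof (rule DERIV_nonneg_imp_nondecreasing[OF assms(1)])
      fix v assume v: "0 \<le> v" "v \<le> u"
      then have "v * cos v \<ge> 0" using True by (intro mult_nonneg_nonneg cos_ge_zero) auto
      then show "\<exists>y. (?s has_real_derivative y) (at v) \<and> y \<ge> 0" using der by blast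
    qed
    then show ?thesis by simp
  next
    case False
    have "?s (20 * pi / 27) \<le> ?s u"
    proof (rule DERIV_nonpos_imp_nonincreasing[OF assms(2)])
      fix v assume v: "u \<le> v" "v \<le> 20 * pi / 27"
      then have "cos v \<le> cos (pi / 2)" using False by (intro cos_monotone_0_pi_le) auto
      then have "v * cos v \<le> 0" using v assms(1) by (simp add: mult_nonneg_nonpos)
      then show "\<exists>y. (?s has_real_derivative y) (at v) \<and> y \<le> 0" using der by blast
    qed
    then show ?thesis using one_minus_cos_div_deriv_nonneg_at_bound by simp
  qed
qed

text \<open>The function \<open>(1 - cos u) / u\<close> is concave only up to \<open>pi\<close>. Beyond \<open>pi\<close> it stays below its
  value there, whereas the tangent line does not decrease.\<close>

lemma one_minus_cos_div_tangent:
  fixes c u :: real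
  assumes c: "0 < c" "c \<le> 20 * pi / 27" and u: "0 < u"
  shows "(1 - cos u) / u \<le> (1 - cos c) / c + (c * sin c - (1 - cos c)) / c\<^sup>2 * (u - c)"
proof -
  \<comment> \<open>The sign is reversed so that concavity becomes convexity and the tangent lies
    below the graph.\<close>
  let ?h = "\<lambda>u::real. - ((1 - cos u) / u)"
  let ?h' = "\<lambda>u::real. ((1 - cos u) - u * sin u) / u\<^sup>2"
  let ?h'' = "\<lambda>u::real. - (u\<^sup>2 * cos u - 2 * u * sin u + 2 * (1 - cos u)) / u ^ 3"
  have h': "(?h has_real_derivative ?h' v) (at v)" if "v > 0" for v
    using that by (auto intro!: derivative_eq_intros simp: field_simps power2_eq_square)
  have h'': "(?h' has_real_derivative ?h'' v) (at v)" if "v > 0" for v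
    using that by (auto intro!: derivative_eq_intros simp: field_simps eval_nat_numeral)
  have convex: "convex_on {0<..pi} ?h"
  proof (rule f''_ge0_imp_convex)
    show "?h'' v \<ge> 0" if "v \<in> {0<..pi}" for v
      using one_minus_cos_div_second_deriv_nonpos[of v] that by (intro divide_nonneg_nonneg) auto
  qed (use h' h'' in auto)
  have cpi: "c < pi" using c pi_gt_zero by linarith
  have tangent: "(1 - cos v) / v \<le> (1 - cos c) / c + (c * sin c - (1 - cos c)) / c\<^sup>2 * (v - c)"
    if v: "v \<in> {0<..pi}" for v
  proof -
    have "?h v - ?h c \<ge> ?h' c * (v - c)"
      using convex v c cpi
      by (intro convex_on_imp_above_tangent[OF convex] has_field_derivative_at_within[OF h']) auto
    moreover have "?h' c = - ((c * sin c - (1 - cos c)) / c\<^sup>2)"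
      by (simp only: minus_divide_left minus_diff_eq)
    ultimately show ?thesis by simp
  qed
  show ?thesis
  proof (cases "u \<le> pi")
    case True
    then show ?thesis using tangent u by simp
  next
    case False
    have "(1 - cos u) / u \<le> 2 / pi"
      using False pi_gt_zero cos_ge_minus_one[of u] by (intro frac_le) auto
    also have "\<dots> \<le> (1 - cos c) / c + (c * sin c - (1 - cos c)) / c\<^sup>2 * (pi - c)"
      using tangent[of pi] by simp
    also have "\<dots> \<le> (1 - cos c) / c + (c * sin c - (1 - cos c)) / c\<^sup>2 * (u - c)"
      using one_minus_cos_div_deriv_nonneg[of c] c False by (intro add_left_mono mult_left_mono) auto
    finally show ?thesis .
  qed
qed

text \<open>The half angle formula turns each summand into \<open>w / 2\<close> times
  \<open>(1 - cos u) / u\<close> at \<open>u = w * L j\<close>. Summing the tangent inequality at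
  the equidistant argument \<open>c\<close> makes the linear terms cancel, because the lengths add
  up to 1 and \<open>(n + 1) * c = w\<close>.\<close>

lemma sum_sin_sq_div_le:
  fixes L :: "nat \<Rightarrow> real"
  assumes k: "k \<noteq> 0" and n: "real n \<ge> 2.7 * \<bar>k\<bar> - 1"
    and L: "\<And>j. j \<le> n \<Longrightarrow> L j > 0" "(\<Sum>j\<le>n. L j) = 1"
  shows "(\<Sum>j\<le>n. (sin (pi * k * L j))\<^sup>2 / L j) \<le> (real n + 1)\<^sup>2 * (sin (k * pi / (real n + 1)))\<^sup>2"
proof -
  define w where "w = 2 * pi * \<bar>k\<bar>"
  define c where "c = w / (real n + 1)"
  have w: "w > 0" using k by (simp add: w_def)
  have c: "c > 0" "c \<le> 20 * pi / 27"
  proof -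
    show "c > 0" using w by (simp add: c_def)
    \<comment> \<open>Since \<open>2 / 2.7 = 20 / 27\<close>, the assumption on \<open>n\<close>
      says exactly that the equidistant argument is at most \<open>20 * pi / 27\<close>.\<close>
    have "2.7 * \<bar>k\<bar> * pi \<le> (real n + 1) * pi" using n by (intro mult_right_mono) auto
    then show "c \<le> 20 * pi / 27" by (simp add: c_def w_def field_simps)
  qed
  define D where "D = (c * sin c - (1 - cos c)) / c\<^sup>2"
  have sq: "(sin (pi * k * l))\<^sup>2 / l = w / 2 * ((1 - cos (w * l)) / (w * l))" for l
  proof -
    have "cos (w * l) = cos (2 * (pi * k * l))"
      by (cases "k \<ge> 0") (simp_all add: w_def mult_ac)
    then show ?thesis using cos_double_sin[of "pi * k * l"] w by simp
  qed
  have "(\<Sum>j\<le>n. (sin (pi * k * L j))\<^sup>2 / L j) \<le> (\<Sum>j\<le>n. w / 2 * ((1 - cos c) / c + D * (w * L j - c)))"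
    unfolding sq D_def using w L c
    by (intro sum_mono mult_left_mono one_minus_cos_div_tangent) auto
  also have "\<dots> = w / 2 * ((real n + 1) * ((1 - cos c) / c) + D * (w * (\<Sum>j\<le>n. L j) - (real n + 1) * c))"
    by (simp only: sum_distrib_left[symmetric] sum.distrib sum_subtractf sum_constant card_atMost of_nat_Suc add.commute)
  also have "(real n + 1) * c = w" by (simp add: c_def)
  also have "w / 2 * ((real n + 1) * ((1 - cos c) / c) + D * (w * (\<Sum>j\<le>n. L j) - w)) =
      (real n + 1) * (w / 2 * ((1 - cos c) / c))"
    by (simp add: L)
  also have "w / 2 * ((1 - cos c) / c) = (sin (pi * k * (1 / (real n + 1))))\<^sup>2 / (1 / (real n + 1))"
    unfolding sq by (simp add: c_def)
  finally show ?thesis by (simp add: power2_eq_square mult_ac)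
qed

section \<open>Node sequences and arbitrary sampling algorithms\<close>

lemma node_sequence_equidistant: "node_sequence n (equidistant_nodes n)"
  by (simp add: node_sequence_def equidistant_nodes_def divide_strict_right_mono)

text \<open>The set is filled up with further points of the open interval to exactly
  \<open>n\<close> elements, sorted, and framed by 0 and 1. This brings algorithms with fewer or
  repeated samples under the node formula.\<close>

lemma node_sequence_covering:
  fixes P :: "real set"
  assumes "finite P" "P \<subseteq> {0<..<1}" "card P \<le> n"
  obtains x where "node_sequence n x" "P \<subseteq> x ` {1..n}"
proof -
  have "infinite ({0<..<1::real} - P)"
    using assms(1) by (simp add: infinite_Ioo)
  then obtain Q where Q: "Q \<subseteq> {0<..<1} - P" "finite Q" "card Q = n - card P"
    using infinite_arbitrarily_large by blast
  define xs where "xs = sorted_list_of_set (P \<union> Q)"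
  have fin: "finite (P \<union> Q)" using assms Q by auto
  have card: "card (P \<union> Q) = n"
    using assms Q by (subst card_Un_disjoint) auto
  have set: "set xs = P \<union> Q" and len: "length xs = n" and sorted: "sorted_wrt (<) xs"
    using fin card by (auto simp: xs_def strict_sorted_list_of_set)
  define ys where "ys = 0 # xs @ [1]"
  have inner: "0 < t \<and> t < 1" if "t \<in> set xs" for t
    using that set assms(2) Q(1) by auto
  have "sorted_wrt (<) ys"
    using sorted inner by (auto simp: ys_def sorted_wrt_append)
  then have "ys ! j < ys ! (j + 1)" if "j \<le> n" for j
    using that len by (intro sorted_wrt_nth_less[of "(<)"]) (auto simp: ys_def)
  moreover have "ys ! 0 = 0" "ys ! (n + 1) = 1"
    using len by (simp_all add: ys_def nth_append)
  ultimately have "node_sequence n (\<lambda>j. ys ! j)"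
    unfolding node_sequence_def by blast
  moreover have "P \<subseteq> (\<lambda>j. ys ! j) ` {1..n}"
  proof
    fix t assume "t \<in> P"
    then obtain i where i: "i < n" "xs ! i = t"
      using set len by (metis UnCI in_set_conv_nth)
    then have "ys ! Suc i = t" using len by (simp add: ys_def nth_append)
    then show "t \<in> (\<lambda>j. ys ! j) ` {1..n}" using i by (force intro: image_eqI[of _ _ "Suc i"])
  qed
  ultimately show thesis by (rule that)
qed

lemma radius_of_osc_information:
  assumes "k \<noteq> 0" "node_sequence n x"
  shows "radius_of_information (weighted_integral (osc_weight k)) (node_information n x) =
    ereal (1 / (2 * pi * \<bar>k\<bar>) *
      sqrt (1 - 1 / (k\<^sup>2 * pi\<^sup>2) * (\<Sum>j\<le>n. (sin (pi * k * (x (Suc j) - x j)))\<^sup>2 / (x (Suc j) - x j))))"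
  using information_nodes.radius_of_node_information[OF osc_information_nodes[OF assms]]
    sqrt_osc_sq_radius[OF assms] by simp

lemma radius_of_equidistant_information:
  assumes "k \<noteq> 0"
  shows "radius_of_information (weighted_integral (osc_weight k)) (node_information n (equidistant_nodes n)) =
    ereal (1 / (2 * pi * \<bar>k\<bar>) *
      sqrt (1 - (real n + 1)\<^sup>2 / (k\<^sup>2 * pi\<^sup>2) * (sin (k * pi / (real n + 1)))\<^sup>2))"
proof -
  have "equidistant_nodes n (Suc j) - equidistant_nodes n j = 1 / (real n + 1)" for j
    by (simp add: equidistant_nodes_def field_simps)
  then have "(\<Sum>j\<le>n. (sin (pi * k * (equidistant_nodes n (Suc j) - equidistant_nodes n j)))\<^sup>2 /
      (equidistant_nodes n (Suc j) - equidistant_nodes n j)) =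
      (real n + 1)\<^sup>2 * (sin (k * pi / (real n + 1)))\<^sup>2"
    by (simp add: power2_eq_square mult_ac add.commute)
  then show ?thesis
    unfolding radius_of_osc_information[OF assms node_sequence_equidistant] by simp
qed

lemma equidistant_radius_le:
  assumes k: "k \<noteq> 0" and n: "real n \<ge> 2.7 * \<bar>k\<bar> - 1" and x: "node_sequence n x"
  shows "radius_of_information (weighted_integral (osc_weight k)) (node_information n (equidistant_nodes n))
    \<le> radius_of_information (weighted_integral (osc_weight k)) (node_information n x)"
proof -
  interpret information_nodes "osc_weight k" "osc_antideriv k" "osc_antideriv2 k" n x
    using k x by (rule osc_information_nodes)
  have "(\<Sum>j\<le>n. x (Suc j) - x j) = 1"
    using sum_lessThan_telescope[of x "Suc n"] by (simp add: node_0 node_Suc lessThan_Suc_atMost)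
  then have "(\<Sum>j\<le>n. (sin (pi * k * (x (Suc j) - x j)))\<^sup>2 / (x (Suc j) - x j))
      \<le> (real n + 1)\<^sup>2 * (sin (k * pi / (real n + 1)))\<^sup>2"
    using node_less by (intro sum_sin_sq_div_le k n) auto
  then have "1 / (k\<^sup>2 * pi\<^sup>2) * (\<Sum>j\<le>n. (sin (pi * k * (x (Suc j) - x j)))\<^sup>2 / (x (Suc j) - x j))
      \<le> 1 / (k\<^sup>2 * pi\<^sup>2) * ((real n + 1)\<^sup>2 * (sin (k * pi / (real n + 1)))\<^sup>2)"
    by (rule mult_left_mono) simp
  then show ?thesis
    unfolding radius_of_equidistant_information[OF k] radius_of_osc_information[OF k x]
    unfolding ereal_less_eq by (intro mult_left_mono real_sqrt_le_mono) auto
qed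

text \<open>For the lower bound, the inner sample points of any algorithm are embedded in a node
  sequence. Its radius bounds the error of the algorithm from below and is in turn at least the
  equidistant radius.\<close>

lemma minimal_error_eq_radius_of_equidistant:
  assumes k: "k \<noteq> 0" and n: "real n \<ge> 2.7 * \<bar>k\<bar> - 1"
  shows "minimal_worst_case_error n (weighted_integral (osc_weight k)) =
    radius_of_information (weighted_integral (osc_weight k)) (node_information n (equidistant_nodes n))"
    (is "?e = ?r")
proof (rule antisym)
  interpret information_nodes "osc_weight k" "osc_antideriv k" "osc_antideriv2 k" n "equidistant_nodes n"
    using k node_sequence_equidistant by (rule osc_information_nodes)
  show "?e \<le> ?r"
    unfolding minimal_worst_case_error_def radius_of_node_information
    using sampling_algorithm_attaining_radius by (blast intro: INF_lower2)
next
  show "?r \<le> ?e"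
    unfolding minimal_worst_case_error_def
  proof (rule INF_greatest)
    fix A assume "A \<in> sampling_algorithms n"
    then obtain xs \<phi> where A: "length xs \<le> n" "set xs \<subseteq> {0..1}" "A = (\<lambda>f. \<phi> (map f xs))"
      by (auto simp: sampling_algorithms_def)
    \<comment> \<open>Sampling at 0 or 1 is allowed; these points are covered by \<open>x 0\<close>
      and \<open>x (Suc n)\<close>, so only the inner ones have to be embedded.\<close>
    let ?P = "set xs \<inter> {0<..<1}"
    have "card ?P \<le> n"
      using A(1) card_length[of xs] card_mono[of "set xs" ?P] by simp
    then obtain x where x: "node_sequence n x" "?P \<subseteq> x ` {1..n}"
      using node_sequence_covering[of ?P n] by blast
    interpret information_nodes "osc_weight k" "osc_antideriv k" "osc_antideriv2 k" n x
      using k x(1) by (rule osc_information_nodes)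
    have "set xs \<subseteq> x ` {..Suc n}"
    proof
      fix t assume t: "t \<in> set xs"
      then consider "t = 0" | "t = 1" | "t \<in> ?P" using A(2) by force
      then show "t \<in> x ` {..Suc n}"
      proof cases
        case 1
        then show ?thesis using node_0 by (intro image_eqI[of _ _ 0]) auto
      next
        case 2
        then show ?thesis using node_Suc by (intro image_eqI[of _ _ "Suc n"]) auto
      next
        case 3
        then show ?thesis using x(2) by fastforce
      qed
    qed
    then have "radius_of_information (weighted_integral (osc_weight k)) (node_information n x)
        \<le> worst_case_error (weighted_integral (osc_weight k)) A"
      unfolding radius_of_node_information A(3) by (rule radius_le_worst_case_error)
    with equidistant_radius_le[OF k n x(1)]
    show "?r \<le> worst_case_error (weighted_integral (osc_weight k)) A" by (rule order_trans)
  qed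
qed

theorem theorem9:
  fixes k :: real and n :: nat
  assumes "k \<noteq> 0" and "n \<ge> 1"
  shows "(\<forall>x L. node_sequence n x \<and> (\<forall>j\<le>n. L j = x (j + 1) - x j) \<longrightarrow>
            radius_of_information (weighted_integral (osc_weight k)) (node_information n x) =
              ereal (1 / (2 * pi * \<bar>k\<bar>) *
                sqrt (1 - 1 / (k\<^sup>2 * pi\<^sup>2) * (\<Sum>j=0..n. (sin (pi * k * L j))\<^sup>2 / L j)))) \<and>
         (real n \<ge> 2.7 * \<bar>k\<bar> - 1 \<longrightarrow>
            is_arg_min
              (\<lambda>x. radius_of_information (weighted_integral (osc_weight k)) (node_information n x))
              (node_sequence n) (equidistant_nodes n) \<and>
            minimal_worst_case_error n (weighted_integral (osc_weight k)) =
              ereal (1 / (2 * pi * \<bar>k\<bar>) *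
                sqrt (1 - (real n + 1)\<^sup>2 / (k\<^sup>2 * pi\<^sup>2) * (sin (k * pi / (real n + 1)))\<^sup>2)))"
proof (intro conjI allI impI)
  fix x L
  assume "node_sequence n x \<and> (\<forall>j\<le>n. L j = x (j + 1) - x j)"
  then show "radius_of_information (weighted_integral (osc_weight k)) (node_information n x) =
      ereal (1 / (2 * pi * \<bar>k\<bar>) *
        sqrt (1 - 1 / (k\<^sup>2 * pi\<^sup>2) * (\<Sum>j=0..n. (sin (pi * k * L j))\<^sup>2 / L j)))"
    using radius_of_osc_information[OF assms(1), of n x] by (simp add: atLeast0AtMost)
next
  assume n: "real n \<ge> 2.7 * \<bar>k\<bar> - 1"
  show "is_arg_min
      (\<lambda>x. radius_of_information (weighted_integral (osc_weight k)) (node_information n x))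
      (node_sequence n) (equidistant_nodes n)"
    using equidistant_radius_le[OF assms(1) n] node_sequence_equidistant
    by (auto simp: is_arg_min_def not_less)
  show "minimal_worst_case_error n (weighted_integral (osc_weight k)) =
      ereal (1 / (2 * pi * \<bar>k\<bar>) *
        sqrt (1 - (real n + 1)\<^sup>2 / (k\<^sup>2 * pi\<^sup>2) * (sin (k * pi / (real n + 1)))\<^sup>2))"
    unfolding minimal_error_eq_radius_of_equidistant[OF assms(1) n]
    by (rule radius_of_equidistant_information[OF assms(1)])
qed

end
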